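(* Let $f:2^{[n]}\to\mathbb{R}_{\geq0}$ be a strongly 2-coverage set function with $f(\emptyset)=0$. Then the polynomial $$q_f(y,x_1,\dots,x_n)=\sum_{i=0}^n y^{n+1-i}\sum_{S\subseteq[n],\,|S|=i}f(S)\prod_{j\in S}x_j$$ is completely log-concave.
   Context: For $\tau\subseteq[n]$, $f_\tau$ denotes the set function on $[n]\setminus\tau$ given by $f_\tau(T)=f(T\cup\tau)$ (equivalently, its generating polynomial is $(\prod_{i\in\tau}\partial_{x_i})\sum_S f(S)x^S$). A function $g:2^{V}\to\mathbb{R}_{\ge0}$ is a coverage function if there are a finite set $U$, subsets $A_i\subseteq U$ ($i\in V$) and a nonnegative measure $w$ on $U$ with $g(T)=w(\bigcup_{i\in T}A_i)$. The function $f$ is strongly 2-coverage if for every $\tau\subseteq[n]$ with $0\le|\tau|\le n-2$ there is a coverage function $g:2^{[n]\setminus\tau}\to\mathbb{R}$ such that $f_\tau(T)=g(T)+f(\tau)$ for every $T\subseteq[n]\setminus\tau$ with $|T|\in\{1,2\}$. A polynomial $p$ in $m$ variables is log-concave if it is nonnegative on $\mathbb{R}^m_{\ge0}$ and $\log p$ is concave there (the zero polynomial counts as log-concave); it is completely log-concave if for every $k\ge0$ and all $a_1,\dots,a_k\in\mathbb{R}^m_{\ge0}$ the polynomial $D_{a_1}\cdots D_{a_k}p$ is nonnegative and log-concave on $\mathbb{R}^m_{\ge0}$, where $D_a=\sum_i a_i\partial_i$. *)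

theory Defs
  imports "HOL-Analysis.Analysis" "HOL-Library.Poly_Mapping"
begin

section \<open>Coverage functions\<close>

text \<open>
  Set functions on the subsets of a finite set V are total functions on sets of which only the
  values on subsets of V matter. A nonnegative measure on a finite set U is given by its
  point weights, and since U is finite it may be taken to be a set of natural numbers.
\<close>

definition coverage_function :: "'a set \<Rightarrow> ('a set \<Rightarrow> real) \<Rightarrow> bool" where
  "coverage_function V g \<longleftrightarrow>
     (\<exists>(U :: nat set) A w. finite U \<and> (\<forall>i\<in>V. A i \<subseteq> U) \<and> (\<forall>u\<in>U. w u \<ge> (0::real)) \<and>
        (\<forall>T\<subseteq>V. g T = (\<Sum>u\<in>(\<Union>i\<in>T. A i). w u)))"

definition link :: "('a set \<Rightarrow> real) \<Rightarrow> 'a set \<Rightarrow> 'a set \<Rightarrow> real" where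
  "link f \<tau> T = f (T \<union> \<tau>)"

definition strongly_2_coverage :: "nat \<Rightarrow> (nat set \<Rightarrow> real) \<Rightarrow> bool" where
  "strongly_2_coverage n f \<longleftrightarrow>
     (\<forall>\<tau>\<subseteq>{1..n}. card \<tau> + 2 \<le> n \<longrightarrow>
        (\<exists>g. coverage_function ({1..n} - \<tau>) g \<and>
             (\<forall>T\<subseteq>{1..n} - \<tau>. card T \<in> {1, 2} \<longrightarrow> link f \<tau> T = g T + f \<tau>)))"

section \<open>Multivariate polynomials\<close>

text \<open>
  Real polynomials in variables indexed by 'v, as finitely supported functions from monomials
  (exponent vectors) to coefficients.
\<close>

type_synonym 'v mpoly = "('v \<Rightarrow>\<^sub>0 nat) \<Rightarrow>\<^sub>0 real"

definition Const :: "real \<Rightarrow> 'v mpoly" where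
  "Const c = Poly_Mapping.single 0 c"

definition Var :: "'v \<Rightarrow> 'v mpoly" where
  "Var i = Poly_Mapping.single (Poly_Mapping.single i 1) 1"

definition eval_mpoly :: "('v \<Rightarrow> real) \<Rightarrow> 'v mpoly \<Rightarrow> real" where
  "eval_mpoly x p =
     (\<Sum>m\<in>Poly_Mapping.keys p.
        Poly_Mapping.lookup p m * (\<Prod>i\<in>Poly_Mapping.keys m. x i ^ Poly_Mapping.lookup m i))"

definition partial_deriv :: "'v \<Rightarrow> 'v mpoly \<Rightarrow> 'v mpoly" where
  "partial_deriv i p =
     (\<Sum>m\<in>Poly_Mapping.keys p.
        Poly_Mapping.single (m - Poly_Mapping.single i 1)
          (real (Poly_Mapping.lookup m i) * Poly_Mapping.lookup p m))"

definition dir_deriv :: "'v set \<Rightarrow> ('v \<Rightarrow> real) \<Rightarrow> 'v mpoly \<Rightarrow> 'v mpoly" where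
  "dir_deriv V a p = (\<Sum>i\<in>V. Const (a i) * partial_deriv i p)"

section \<open>Complete log-concavity\<close>

text \<open>
  Below V is the finite set of variables. A point of the nonnegative orthant is a function that
  is nonnegative on V; its values outside V are irrelevant for polynomials in the variables V.
\<close>

definition nonneg_orthant :: "'v set \<Rightarrow> ('v \<Rightarrow> real) set" where
  "nonneg_orthant V = {x. \<forall>i\<in>V. 0 \<le> x i}"

text \<open>
  Concavity of log p on the closed orthant is that of an extended-real function, with
  log 0 = - \<infinity>. In particular the zero polynomial is log-concave.
\<close>

definition elog :: "real \<Rightarrow> ereal" where
  "elog r = (if r = 0 then - \<infinity> else ereal (ln r))"

definition log_concave :: "'v set \<Rightarrow> 'v mpoly \<Rightarrow> bool" where
  "log_concave V p \<longleftrightarrow>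
     (\<forall>x\<in>nonneg_orthant V. 0 \<le> eval_mpoly x p) \<and>
     (\<forall>x\<in>nonneg_orthant V. \<forall>y\<in>nonneg_orthant V. \<forall>t\<in>{0..1}.
        ereal (1 - t) * elog (eval_mpoly x p) + ereal t * elog (eval_mpoly y p)
          \<le> elog (eval_mpoly (\<lambda>i. (1 - t) * x i + t * y i) p))"

definition completely_log_concave :: "'v set \<Rightarrow> 'v mpoly \<Rightarrow> bool" where
  "completely_log_concave V p \<longleftrightarrow>
     (\<forall>as. set as \<subseteq> nonneg_orthant V \<longrightarrow> log_concave V (foldr (dir_deriv V) as p))"

section \<open>The polynomial of a set function\<close>

text \<open>Variable 0 plays the role of y and variable j, for j in {1..n}, that of the j-th x.\<close>

definition q_poly :: "nat \<Rightarrow> (nat set \<Rightarrow> real) \<Rightarrow> nat mpoly" where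
  "q_poly n f =
     (\<Sum>i = 0..n. Var 0 ^ (n + 1 - i) *
        (\<Sum>S | S \<subseteq> {1..n} \<and> card S = i. Const (f S) * (\<Prod>j\<in>S. Var j)))"

end

theory Submission
  imports Defs
begin

text \<open>
  The polarization of q is a symmetric multilinear form, and log-concavity of all its directional
  derivatives follows from the Alexandrov--Fenchel inequality for that form. This inequality is
  proved by induction on the number of directions (the trickle-down argument): if a symmetric
  nonnegative form M is a positive combination, with weights a, of forms M_i that have at most one
  positive eigenvalue and are the slices of a symmetric tensor, then the reverse Cauchy--Schwarz
  inequalities for the M_i at a add up to N^2 \<ge> N for the operator N with N a = a obtained from M
  by a diagonal scaling. No eigenvalue of N lies strictly between 0 and 1, and 1 is the largest
  one; it is simple because every variable is joined to y, so M has one positive eigenvalue.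

  In the base case, the quadratic derivatives, the coverage condition makes the form nonpositive on
  an explicit hyperplane.
\<close>

section \<open>Quadratic forms with at most one positive eigenvalue\<close>

text \<open>Two features of the trickle-down step shape the rest. It divides by the weights, so it
  needs strictly positive directions; the boundary of the orthant is reached by adding a small
  constant to every direction and letting it tend to 0. And no spectral theorem is invoked: an
  eigenvector is replaced by a maximiser of the Rayleigh quotient on one hyperplane, tested in the
  single direction N x.

  The total degree n + 1 is what fits the base case. Of the n - 1 fixed directions let k be y and
  let the others form a set tau of x-variables (a repeated x-variable makes the form vanish). Then
  exactly k + 1 x-variables remain, and the y-derivatives put the factors (k+2)!, (k+1)!, k! in
  front of the entries with two, one and no further y. On the chosen hyperplane the contribution of
  f(tau) is then nonpositive by X^2 <= (k+1) * (sum of squares), the Cauchy-Schwarz inequality for k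
  + 1 numbers, with no slack to spare.\<close>

definition bil :: "'v set \<Rightarrow> ('v \<Rightarrow> 'v \<Rightarrow> real) \<Rightarrow> ('v \<Rightarrow> real) \<Rightarrow> ('v \<Rightarrow> real) \<Rightarrow> real" where
  "bil V M x y = (\<Sum>i\<in>V. \<Sum>j\<in>V. M i j * x i * y j)"

text \<open>The reverse Cauchy-Schwarz inequality encodes having at most one positive eigenvalue, in
  the form in which the trickle-down step consumes it. The guard on \<open>y\<close> is essential:
  two independent vectors violate the inequality for a negative definite form.\<close>

definition hyperbolic :: "'v set \<Rightarrow> ('v \<Rightarrow> 'v \<Rightarrow> real) \<Rightarrow> bool" where
  "hyperbolic V M \<longleftrightarrow>
     (\<forall>x y. 0 \<le> bil V M y y \<longrightarrow> bil V M x x * bil V M y y \<le> (bil V M x y)\<^sup>2)"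

lemma bil_combine:
  "bil V M (\<lambda>i. s * x i + t * y i) z = s * bil V M x z + t * bil V M y z"
  by (simp add: bil_def sum_distrib_left sum.distrib [symmetric] algebra_simps)

lemma bil_commute:
  assumes "\<And>i j. i \<in> V \<Longrightarrow> j \<in> V \<Longrightarrow> M i j = M j i"
  shows "bil V M x y = bil V M y x"
proof -
  have "bil V M x y = (\<Sum>j\<in>V. \<Sum>i\<in>V. M i j * x i * y j)"
    unfolding bil_def by (rule sum.swap)
  also have "\<dots> = bil V M y x"
    unfolding bil_def by (intro sum.cong refl) (use assms in \<open>simp add: mult_ac\<close>)
  finally show ?thesis .
qed

lemma bil_combine_diag:
  assumes "\<And>i j. i \<in> V \<Longrightarrow> j \<in> V \<Longrightarrow> M i j = M j i"
  shows "bil V M (\<lambda>i. s * x i + t * y i) (\<lambda>i. s * x i + t * y i) =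
    s\<^sup>2 * bil V M x x + 2 * s * t * bil V M x y + t\<^sup>2 * bil V M y y"
proof -
  have right: "bil V M z (\<lambda>i. s * x i + t * y i) = s * bil V M z x + t * bil V M z y" for z
    using bil_combine[of V M s x t y z] bil_commute[of V M, OF assms] by simp
  show ?thesis
    unfolding bil_combine right using bil_commute[of V M y x, OF assms]
    by (simp add: power2_eq_square algebra_simps)
qed

text \<open>A vector \<open>y\<close> of positive value lies off the hyperplane L = 0, and z = L(y)
  x - L(x) y is the combination of \<open>x\<close> and \<open>y\<close> that lies on it. Completing
  the square in B(y,y) B(z,z) leaves a positive multiple of the discriminant, so a violated
  inequality would make B(z,z) positive.\<close>

lemma hyperbolic_if_nonpos_on_hyperplane:
  assumes sym: "\<And>i j. i \<in> V \<Longrightarrow> j \<in> V \<Longrightarrow> M i j = M j i"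
    and neg: "\<And>z. (\<Sum>i\<in>V. c i * z i) = 0 \<Longrightarrow> bil V M z z \<le> 0"
  shows "hyperbolic V M"
  unfolding hyperbolic_def
proof (intro allI impI, rule ccontr)
  fix x y
  assume y0: "0 \<le> bil V M y y"
    and "\<not> bil V M x x * bil V M y y \<le> (bil V M x y)\<^sup>2"
  then have gt: "(bil V M x y)\<^sup>2 < bil V M x x * bil V M y y" by simp
  then have "bil V M x x * bil V M y y > 0"
    by (smt (verit) zero_le_power2)
  with y0 have ypos: "0 < bil V M y y" by (cases "bil V M y y = 0") auto
  define L where "L z = (\<Sum>i\<in>V. c i * z i)" for z
  have Ly: "L y \<noteq> 0" using neg[of y] ypos unfolding L_def by force
  define z where "z = (\<lambda>i. L y * x i + (- L x) * y i)"
  have "L (\<lambda>i. s * x i + t * y i) = s * L x + t * L y" for s t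
    unfolding L_def by (simp add: sum_distrib_left sum.distrib[symmetric] algebra_simps)
  from this[of "L y" "- L x"] have "L z = 0" unfolding z_def by simp
  then have "bil V M z z \<le> 0" using neg[of z] unfolding L_def by simp
  then have le: "bil V M y y * bil V M z z \<le> 0"
    using ypos by (simp add: mult_nonneg_nonpos)
  have zz: "bil V M z z = (L y)\<^sup>2 * bil V M x x + 2 * L y * (- L x) * bil V M x y
      + (- L x)\<^sup>2 * bil V M y y"
    unfolding z_def by (rule bil_combine_diag[of V M, OF sym])
  have "bil V M y y * bil V M z z = (L x * bil V M y y - L y * bil V M x y)\<^sup>2 +
      (L y)\<^sup>2 * (bil V M x x * bil V M y y - (bil V M x y)\<^sup>2)"
    unfolding zz by (simp add: power2_eq_square algebra_simps)
  moreover have "(L y)\<^sup>2 * (bil V M x x * bil V M y y - (bil V M x y)\<^sup>2) > 0"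
    using gt Ly by simp
  ultimately show False using le by (smt (verit) zero_le_power2)
qed

section \<open>Maximising a Rayleigh quotient on a hyperplane\<close>

text \<open>First-order optimality without calculus: a quadratic in t that vanishes at 0 and is
  nowhere negative has no linear term.\<close>

lemma linear_coeff_zero:
  fixes p q :: real
  assumes "\<And>t. 0 \<le> t\<^sup>2 * p + 2 * t * q"
  shows "q = 0"
proof (rule ccontr)
  assume q: "q \<noteq> 0"
  \<comment> \<open>At t = - q / s the value is q^2 (p - 2 s) / s^2, negative as soon as s is
    positive and exceeds p.\<close>
  define s where "s = \<bar>p\<bar> + 1"
  have s: "s > 0" "p < s" unfolding s_def by auto
  have "0 \<le> (- q / s)\<^sup>2 * p + 2 * (- q / s) * q" by (rule assms)
  then have "0 \<le> s\<^sup>2 * ((- q / s)\<^sup>2 * p + 2 * (- q / s) * q)" by simp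
  also have "\<dots> = q\<^sup>2 * (p - 2 * s)"
    using s by (simp add: power2_eq_square field_simps)
  also have "\<dots> < 0" using s q by (simp add: mult_pos_neg)
  finally show False by simp
qed

text \<open>Tychonoff's theorem: vectors are functions on a type that may be infinite, so
  compactness is that of a product.\<close>

lemma compact_coordinate_box:
  fixes S :: "'v \<Rightarrow> real set"
  assumes "\<And>i. compact (S i)"
  shows "compact {x. \<forall>i. x i \<in> S i}"
proof -
  have "compactin (product_topology (\<lambda>i. euclidean) UNIV) (PiE UNIV S)"
    unfolding compactin_PiE using assms by simp
  moreover have "PiE UNIV S = {x. \<forall>i. x i \<in> S i}" by (auto simp: PiE_def)
  ultimately show ?thesis by (simp add: euclidean_product_topology)
qed

lemma nonneg_sum_eq_zeroD:
  fixes g :: "'v \<Rightarrow> real"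
  assumes "finite V" "\<And>i. i \<in> V \<Longrightarrow> 0 \<le> g i" "sum g V = 0" "i \<in> V"
  shows "g i = 0"
  using assms sum_nonneg_eq_0_iff by blast

text \<open>Stands in for a top eigenvector of \<open>M\<close>, relative to the weights
  \<open>Dg\<close>, on a hyperplane. The vector \<open>z\<close> makes the constraint set nonempty;
  the bound is homogenised so that \<open>h\<close> need not be normalised.\<close>

lemma weighted_sphere_attains_max:
  fixes Dg c :: "'v \<Rightarrow> real"
  assumes fin: "finite W" and D: "\<And>i. i \<in> W \<Longrightarrow> 0 < Dg i"
    and z: "(\<Sum>i\<in>W. c i * z i) = 0" "0 < (\<Sum>i\<in>W. Dg i * (z i)\<^sup>2)"
  obtains x where "(\<Sum>i\<in>W. c i * x i) = 0" "(\<Sum>i\<in>W. Dg i * (x i)\<^sup>2) = 1"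
    "\<And>h. (\<Sum>i\<in>W. c i * h i) = 0 \<Longrightarrow>
       bil W M h h \<le> bil W M x x * (\<Sum>i\<in>W. Dg i * (h i)\<^sup>2)"
proof -
  define nr where "nr h = (\<Sum>i\<in>W. Dg i * (h i)\<^sup>2)" for h
  define L where "L h = (\<Sum>i\<in>W. c i * h i)" for h
  \<comment> \<open>Unit norm bounds each coordinate in \<open>W\<close> by
    \<open>sqrt (1 / Dg i)\<close>. Coordinates outside \<open>W\<close> enter none of the sums and
    are pinned to 0.\<close>
  define S where "S i = (if i \<in> W then {- sqrt (1 / Dg i)..sqrt (1 / Dg i)} else {0})" for i
  define K where "K = {x. \<forall>i. x i \<in> S i} \<inter> {x. nr x = 1} \<inter> {x. L x = 0}"
  have contc: "continuous_on UNIV (\<lambda>x :: 'v \<Rightarrow> real. x i)" for i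
    by (rule continuous_on_product_coordinates)
  have "closed {x. nr x = 1}" "closed {x. L x = 0}"
    unfolding nr_def L_def by (intro closed_Collect_eq continuous_intros contc)+
  moreover have "compact {x. \<forall>i. x i \<in> S i}"
    by (rule compact_coordinate_box) (simp add: S_def)
  ultimately have "compact K" unfolding K_def by (intro compact_Int_closed)
  have norm_in: "(\<lambda>i. if i \<in> W then h i / sqrt (nr h) else 0) \<in> K"
    if "L h = 0" "0 < nr h" for h
  proof -
    define g where "g = (\<lambda>i. if i \<in> W then h i / sqrt (nr h) else 0)"
    have "nr g = (\<Sum>i\<in>W. Dg i * (h i)\<^sup>2 / nr h)"
      unfolding nr_def[of g] by (intro sum.cong) (use that in \<open>auto simp: g_def power_divide\<close>)
    also have "\<dots> = 1" using that by (simp add: sum_divide_distrib[symmetric] nr_def[symmetric])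
    finally have n1: "nr g = 1" .
    have "L g = (\<Sum>i\<in>W. c i * h i / sqrt (nr h))"
      unfolding L_def by (intro sum.cong) (auto simp: g_def)
    also have "\<dots> = 0" using that by (simp add: sum_divide_distrib[symmetric] L_def[symmetric])
    finally have L0: "L g = 0" .
    have "g i \<in> S i" for i
    proof (cases "i \<in> W")
      case True
      have "Dg i * (g i)\<^sup>2 \<le> nr g"
        unfolding nr_def
        by (rule member_le_sum[OF True _ fin]) (use D in \<open>auto simp: less_imp_le\<close>)
      then have "(g i)\<^sup>2 \<le> 1 / Dg i" using n1 D[OF True] by (simp add: field_simps)
      then have "\<bar>g i\<bar> \<le> sqrt (1 / Dg i)" by (simp add: real_le_rsqrt)
      then show ?thesis using True unfolding S_def by auto
    qed (simp add: S_def g_def)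
    then show ?thesis using n1 L0 unfolding K_def g_def by simp
  qed
  have "K \<noteq> {}" using norm_in[of z] z unfolding L_def nr_def by blast
  moreover have "continuous_on K (\<lambda>x. bil W M x x)"
    unfolding bil_def by (intro continuous_intros continuous_on_subset[OF contc]) auto
  ultimately obtain x where x: "x \<in> K" "\<And>y. y \<in> K \<Longrightarrow> bil W M y y \<le> bil W M x x"
    using continuous_attains_sup[OF \<open>compact K\<close>, of "\<lambda>x. bil W M x x"] by blast
  show ?thesis
  proof (rule that[of x])
    show "(\<Sum>i\<in>W. c i * x i) = 0" "(\<Sum>i\<in>W. Dg i * (x i)\<^sup>2) = 1"
      using x(1) unfolding K_def L_def nr_def by auto
    fix h assume "(\<Sum>i\<in>W. c i * h i) = 0"
    then have L: "L h = 0" unfolding L_def .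
    have nn: "0 \<le> Dg i * (h i)\<^sup>2" if "i \<in> W" for i using D[OF that] by simp
    have "bil W M h h \<le> bil W M x x * nr h"
    proof (cases "nr h = 0")
      case True
      have "h i = 0" if "i \<in> W" for i
        using nonneg_sum_eq_zeroD[of W "\<lambda>i. Dg i * (h i)\<^sup>2", OF fin nn] True D that
        unfolding nr_def by force
      then have "bil W M h h = 0" unfolding bil_def by simp
      then show ?thesis using True by simp
    next
      case False
      then have pos: "0 < nr h" using sum_nonneg[of W "\<lambda>i. Dg i * (h i)\<^sup>2", OF nn]
        unfolding nr_def by simp
      have "bil W M (\<lambda>i. if i \<in> W then h i / sqrt (nr h) else 0)
              (\<lambda>i. if i \<in> W then h i / sqrt (nr h) else 0) =
            (\<Sum>i\<in>W. \<Sum>j\<in>W. M i j * h i * h j / nr h)"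
        unfolding bil_def by (intro sum.cong refl) (use pos in simp)
      also have "\<dots> = bil W M h h / nr h"
        unfolding bil_def by (simp add: sum_divide_distrib)
      finally have "bil W M h h / nr h \<le> bil W M x x" using x(2)[OF norm_in[OF L pos]] by simp
      then show ?thesis using pos by (simp add: field_simps)
    qed
    then show "bil W M h h \<le> bil W M x x * (\<Sum>i\<in>W. Dg i * (h i)\<^sup>2)" unfolding nr_def .
  qed
qed

text \<open>The Laplacian of the weighted graph with edge weights M i j * a i * a j, applied to x /
  a. For nonnegative \<open>M\<close> and positive \<open>a\<close> it shows that \<open>M\<close>
  is at most 1 relative to the weights (M a) i / a i, with equality only if x / a is constant along
  edges.\<close>

lemma dirichlet_identity:
  fixes M :: "'v \<Rightarrow> 'v \<Rightarrow> real"
  assumes sym: "\<And>i j. i \<in> W \<Longrightarrow> j \<in> W \<Longrightarrow> M i j = M j i"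
    and a: "\<And>i. i \<in> W \<Longrightarrow> a i \<noteq> 0"
  shows "(\<Sum>i\<in>W. \<Sum>j\<in>W. M i j * a i * a j * (x i / a i - x j / a j)\<^sup>2) =
    2 * ((\<Sum>i\<in>W. (\<Sum>j\<in>W. M i j * a j) / a i * (x i)\<^sup>2) - bil W M x x)"
proof -
  have "(\<Sum>i\<in>W. \<Sum>j\<in>W. M i j * a i * a j * (x i / a i - x j / a j)\<^sup>2) =
    (\<Sum>i\<in>W. \<Sum>j\<in>W. M i j * a j / a i * (x i)\<^sup>2 + M j i * a i / a j * (x j)\<^sup>2
       - 2 * (M i j * x i * x j))"
  proof (intro sum.cong refl)
    fix i j assume ij: "i \<in> W" "j \<in> W"
    have "M i j * a i * a j * (x i / a i - x j / a j)\<^sup>2 =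
        M i j * a j / a i * (x i)\<^sup>2 + M i j * a i / a j * (x j)\<^sup>2 - 2 * (M i j * x i * x j)"
      using a[OF ij(1)] a[OF ij(2)] by (simp add: power2_eq_square field_simps)
    then show "M i j * a i * a j * (x i / a i - x j / a j)\<^sup>2 =
        M i j * a j / a i * (x i)\<^sup>2 + M j i * a i / a j * (x j)\<^sup>2 - 2 * (M i j * x i * x j)"
      using sym[OF ij] by simp
  qed
  also have "\<dots> = (\<Sum>i\<in>W. \<Sum>j\<in>W. M i j * a j / a i * (x i)\<^sup>2)
      + (\<Sum>i\<in>W. \<Sum>j\<in>W. M j i * a i / a j * (x j)\<^sup>2) - 2 * bil W M x x"
    by (simp add: bil_def sum.distrib sum_subtractf sum_distrib_left)
  also have "(\<Sum>i\<in>W. \<Sum>j\<in>W. M j i * a i / a j * (x j)\<^sup>2) =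
      (\<Sum>i\<in>W. \<Sum>j\<in>W. M i j * a j / a i * (x i)\<^sup>2)"
    by (rule sum.swap)
  also have "(\<Sum>i\<in>W. \<Sum>j\<in>W. M i j * a j / a i * (x i)\<^sup>2) =
      (\<Sum>i\<in>W. (\<Sum>j\<in>W. M i j * a j) / a i * (x i)\<^sup>2)"
    by (simp add: sum_divide_distrib sum_distrib_right)
  finally show ?thesis by simp
qed

section \<open>The trickle-down step\<close>

lemma bil_mult_vector:
  "bil V M x y = (\<Sum>i\<in>V. x i * (\<Sum>j\<in>V. M i j * y j))"
  by (simp add: bil_def sum_distrib_left mult_ac)

text \<open>If the form were positive somewhere on the hyperplane with normal c = M a, a maximiser x
  of the Rayleigh quotient there would have value at least 1. The Dirichlet identity then forces x
  to be proportional to \<open>a\<close>, which does not lie on that hyperplane. Condition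
  \<open>conn\<close> makes the graph of \<open>M\<close> a connected one around \<open>hub\<close>
  once zero rows are discarded.\<close>

lemma hyperbolic_weighted_sum:
  fixes T :: "'v \<Rightarrow> 'v \<Rightarrow> 'v \<Rightarrow> real"
  assumes fin: "finite V" and hub: "hub \<in> V"
    and a: "\<And>i. i \<in> V \<Longrightarrow> 0 < a i"
    and nonneg: "\<And>i j k. i \<in> V \<Longrightarrow> j \<in> V \<Longrightarrow> k \<in> V \<Longrightarrow> 0 \<le> T i j k"
    and sym12: "\<And>i j k. i \<in> V \<Longrightarrow> j \<in> V \<Longrightarrow> k \<in> V \<Longrightarrow> T i j k = T j i k"
    and sym23: "\<And>i j k. i \<in> V \<Longrightarrow> j \<in> V \<Longrightarrow> k \<in> V \<Longrightarrow> T i j k = T i k j"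
    and hyp: "\<And>i. i \<in> V \<Longrightarrow> hyperbolic V (T i)"
    and M: "\<And>j k. j \<in> V \<Longrightarrow> k \<in> V \<Longrightarrow> M j k = (\<Sum>i\<in>V. a i * T i j k)"
    and conn: "\<And>i j. i \<in> V \<Longrightarrow> j \<in> V \<Longrightarrow> i \<noteq> hub \<Longrightarrow> M i j \<noteq> 0 \<Longrightarrow> M i hub \<noteq> 0"
  shows "hyperbolic V M"
proof -
  have sym: "M i j = M j i" if "i \<in> V" "j \<in> V" for i j
    unfolding M[OF that] M[OF that(2,1)]
    by (intro sum.cong refl arg_cong2[where f = "(*)"] sym23 that)
  have Mnn: "0 \<le> M i j" if "i \<in> V" "j \<in> V" for i j
    unfolding M[OF that] by (intro sum_nonneg mult_nonneg_nonneg less_imp_le[OF a] nonneg that)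
  define mv where "mv x i = (\<Sum>j\<in>V. M i j * x j)" for x i
  define c where "c i = mv a i" for i
  have cnn: "0 \<le> c i" if "i \<in> V" for i
    unfolding c_def mv_def by (intro sum_nonneg mult_nonneg_nonneg less_imp_le[OF a] Mnn that)
  \<comment> \<open>The weights c i / a i must be positive, and the argument divides by c i. Rows
    with c i = 0 vanish entirely, so nothing is lost by restricting to \<open>W\<close>.\<close>
  define W where "W = {i \<in> V. 0 < c i}"
  have WV: "W \<subseteq> V" and finW: "finite W" using fin unfolding W_def by auto
  have row0: "M i j = 0" if "i \<in> V - W" "j \<in> V" for i j
  proof -
    have "c i = 0" using that cnn[of i] unfolding W_def by force
    then have "M i j * a j = 0" unfolding c_def mv_def
      by (intro nonneg_sum_eq_zeroD[of V "\<lambda>j. M i j * a j"]) (use that fin Mnn a in \<open>auto simp: less_imp_le\<close>)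
    then show ?thesis using a[OF that(2)] by simp
  qed
  have mvW: "(\<Sum>j\<in>W. M i j * x j) = mv x i" if "i \<in> V" for i x
    unfolding mv_def by (rule sum.mono_neutral_left)
      (use fin WV row0 sym that in \<open>auto\<close>)
  have bilW: "bil W M x y = (\<Sum>i\<in>W. x i * mv y i)" for x y
    unfolding bil_mult_vector by (intro sum.cong refl) (use mvW WV in auto)
  have bilWV: "bil V M x y = bil W M x y" for x y
    unfolding bilW unfolding bil_mult_vector mv_def[symmetric]
  proof (rule sum.mono_neutral_right)
    show "\<forall>i\<in>V - W. x i * mv y i = 0" using row0 by (auto simp: mv_def)
  qed (use fin WV in auto)
  \<comment> \<open>By symmetry of \<open>T\<close>, contracting any one slot with \<open>a\<close>
    gives \<open>M\<close>. In particular the slice \<open>T i\<close> takes the value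
    \<open>c i\<close> at the pair \<open>a\<close>, \<open>a\<close>.\<close>
  have Taa: "bil V (T i) x a = mv x i" if i: "i \<in> V" for i x
  proof -
    have "bil V (T i) x a = (\<Sum>j\<in>V. x j * (\<Sum>k\<in>V. T i j k * a k))" by (rule bil_mult_vector)
    also have "\<dots> = (\<Sum>j\<in>V. M i j * x j)"
    proof (intro sum.cong refl)
      fix j assume j: "j \<in> V"
      have "T i j k = T k i j" if "k \<in> V" for k
        using sym12 sym23 i j that by metis
      then have "(\<Sum>k\<in>V. T i j k * a k) = M i j" using i j by (simp add: M mult.commute)
      then show "x j * (\<Sum>k\<in>V. T i j k * a k) = M i j * x j" by simp
    qed
    finally show ?thesis unfolding mv_def .
  qed
  have sum_T: "bil V M x x = (\<Sum>i\<in>V. a i * bil V (T i) x x)" for x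
  proof -
    have "bil V M x x = (\<Sum>j\<in>V. \<Sum>k\<in>V. \<Sum>i\<in>V. a i * (T i j k * x j * x k))"
      unfolding bil_def by (intro sum.cong refl) (simp add: M sum_distrib_left sum_distrib_right mult_ac)
    also have "\<dots> = (\<Sum>j\<in>V. \<Sum>i\<in>V. \<Sum>k\<in>V. a i * (T i j k * x j * x k))"
      by (intro sum.cong refl sum.swap)
    also have "\<dots> = (\<Sum>i\<in>V. \<Sum>j\<in>V. \<Sum>k\<in>V. a i * (T i j k * x j * x k))"
      by (rule sum.swap)
    finally show ?thesis by (simp add: bil_def sum_distrib_left)
  qed
  \<comment> \<open>For i in \<open>W\<close> the slice has value c i > 0 at \<open>a\<close>, so
    its reverse Cauchy-Schwarz inequality may be divided by c i. In the inner product with weights c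
    i / a i the right-hand side is the squared norm of N x.\<close>
  have key: "bil V M x x \<le> (\<Sum>i\<in>W. a i / c i * (mv x i)\<^sup>2)" for x
  proof -
    have "bil V M x x = (\<Sum>i\<in>W. a i * bil V (T i) x x)"
      unfolding sum_T
    proof (rule sum.mono_neutral_right)
      show "\<forall>i\<in>V - W. a i * bil V (T i) x x = 0"
      proof
        fix i assume i: "i \<in> V - W"
        have "T i j k = 0" if jk: "j \<in> V" "k \<in> V" for j k
        proof -
          have "M i j = 0" using row0 i jk by blast
          then have "a k * T k i j = 0"
            using i jk by (intro nonneg_sum_eq_zeroD[of V "\<lambda>k. a k * T k i j"])
              (use fin a nonneg M in \<open>auto simp: less_imp_le\<close>)
          then show ?thesis using a[OF jk(2)] sym12 sym23 i jk by (metis DiffD1 less_irrefl mult_eq_0_iff)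
        qed
        then show "a i * bil V (T i) x x = 0" unfolding bil_def by simp
      qed
    qed (use fin WV in auto)
    also have "\<dots> \<le> (\<Sum>i\<in>W. a i / c i * (mv x i)\<^sup>2)"
    proof (rule sum_mono)
      fix i assume i: "i \<in> W"
      then have iV: "i \<in> V" and ci: "0 < c i" unfolding W_def by auto
      have "bil V (T i) x x * c i \<le> (mv x i)\<^sup>2"
        using hyp[OF iV] ci Taa[OF iV] unfolding hyperbolic_def c_def by (metis less_imp_le)
      then have "bil V (T i) x x \<le> (mv x i)\<^sup>2 / c i" using ci by (simp add: field_simps)
      then show "a i * bil V (T i) x x \<le> a i / c i * (mv x i)\<^sup>2"
        using mult_left_mono[of _ _ "a i"] a[OF iV] by fastforce
    qed
    finally show ?thesis .
  qed
  define Dg where "Dg i = c i / a i" for i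
  have Dpos: "0 < Dg i" if "i \<in> W" for i
    using that a unfolding W_def Dg_def by auto
  have symW: "\<And>i j. i \<in> W \<Longrightarrow> j \<in> W \<Longrightarrow> M i j = M j i" using sym WV by blast
  \<comment> \<open>Since Dg i * a i = c i, this hyperplane is the orthogonal complement of
    \<open>a\<close> in the inner product with weights \<open>Dg\<close>.\<close>
  have neg: "bil V M z z \<le> 0" if "(\<Sum>i\<in>V. c i * z i) = 0" for z
  proof (rule ccontr)
    assume pos: "\<not> ?thesis"
    have cz: "(\<Sum>i\<in>W. c i * z i) = 0"
    proof -
      have "(\<Sum>i\<in>W. c i * z i) = (\<Sum>i\<in>V. c i * z i)"
        by (rule sum.mono_neutral_left) (use fin WV cnn in \<open>force simp: W_def\<close>)+
      then show ?thesis using that by simp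
    qed
    have "0 \<noteq> (\<Sum>i\<in>W. Dg i * (z i)\<^sup>2)"
    proof
      assume "0 = (\<Sum>i\<in>W. Dg i * (z i)\<^sup>2)"
      then have "Dg i * (z i)\<^sup>2 = 0" if "i \<in> W" for i
        by (intro nonneg_sum_eq_zeroD[of W "\<lambda>i. Dg i * (z i)\<^sup>2"]) (use that finW Dpos in \<open>auto simp: less_imp_le\<close>)
      then have "bil W M z z = 0" using Dpos unfolding bilW by (force intro: sum.neutral)
      then show False using pos bilWV by simp
    qed
    moreover have "0 \<le> (\<Sum>i\<in>W. Dg i * (z i)\<^sup>2)"
      by (intro sum_nonneg mult_nonneg_nonneg) (use Dpos in \<open>auto simp: less_imp_le\<close>)
    ultimately have zpos: "0 < (\<Sum>i\<in>W. Dg i * (z i)\<^sup>2)" by simp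
    obtain x where x: "(\<Sum>i\<in>W. c i * x i) = 0" "(\<Sum>i\<in>W. Dg i * (x i)\<^sup>2) = 1"
      and mx: "\<And>h. (\<Sum>i\<in>W. c i * h i) = 0 \<Longrightarrow>
        bil W M h h \<le> bil W M x x * (\<Sum>i\<in>W. Dg i * (h i)\<^sup>2)"
      using weighted_sphere_attains_max[where M = M, OF finW Dpos cz zpos] by blast
    define lam where "lam = bil W M x x"
    have lam: "0 < lam"
      using mx[OF cz] pos zpos unfolding lam_def bilWV by (smt (verit) mult_nonpos_nonneg)
    \<comment> \<open>This is N x. It is tangent to the hyperplane because its pairing with c equals
      that of M x with \<open>a\<close>, hence that of x with c, by symmetry of
      \<open>M\<close>.\<close>
    define h where "h i = mv x i / Dg i" for i
    have "(\<Sum>i\<in>W. c i * h i) = (\<Sum>i\<in>W. a i * mv x i)"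
      by (intro sum.cong refl) (use Dpos in \<open>auto simp: h_def Dg_def W_def\<close>)
    also have "\<dots> = bil W M a x" by (rule bilW[symmetric])
    also have "\<dots> = bil W M x a" by (rule bil_commute[OF symW])
    also have "\<dots> = 0" using x(1) unfolding bilW c_def[symmetric] by (simp add: mult.commute)
    finally have ch: "(\<Sum>i\<in>W. c i * h i) = 0" .
    \<comment> \<open>First-order optimality of x: the gradient of the Rayleigh quotient vanishes along h.\<close>
    have "lam * (\<Sum>i\<in>W. Dg i * x i * h i) - bil W M x h = 0"
    proof (rule linear_coeff_zero)
      fix t :: real
      define y where "y = (\<lambda>i. 1 * x i + t * h i)"
      have "(\<Sum>i\<in>W. c i * y i) = (\<Sum>i\<in>W. c i * x i) + t * (\<Sum>i\<in>W. c i * h i)"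
        unfolding y_def by (simp add: sum_distrib_left sum.distrib[symmetric] algebra_simps)
      then have "bil W M y y \<le> lam * (\<Sum>i\<in>W. Dg i * (y i)\<^sup>2)"
        unfolding lam_def using x ch by (intro mx) simp
      moreover have "bil W M y y = 1\<^sup>2 * lam + 2 * 1 * t * bil W M x h + t\<^sup>2 * bil W M h h"
        unfolding y_def lam_def by (rule bil_combine_diag[OF symW])
      moreover have "(\<Sum>i\<in>W. Dg i * (y i)\<^sup>2) = (\<Sum>i\<in>W. Dg i * (x i)\<^sup>2)
          + 2 * t * (\<Sum>i\<in>W. Dg i * x i * h i) + t\<^sup>2 * (\<Sum>i\<in>W. Dg i * (h i)\<^sup>2)"
        unfolding y_def by (simp add: sum_distrib_left sum.distrib[symmetric] power2_eq_square algebra_simps)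
      ultimately show "0 \<le> t\<^sup>2 * (lam * (\<Sum>i\<in>W. Dg i * (h i)\<^sup>2) - bil W M h h)
          + 2 * t * (lam * (\<Sum>i\<in>W. Dg i * x i * h i) - bil W M x h)"
        unfolding x(2) by (simp add: algebra_simps)
    qed
    moreover have "(\<Sum>i\<in>W. Dg i * x i * h i) = lam"
      unfolding lam_def bilW by (intro sum.cong refl) (use Dpos in \<open>force simp: h_def\<close>)
    moreover have "bil W M x h = (\<Sum>i\<in>W. a i / c i * (mv x i)\<^sup>2)"
    proof -
      have "bil W M x h = bil W M h x" by (rule bil_commute[OF symW])
      also have "\<dots> = (\<Sum>i\<in>W. a i / c i * (mv x i)\<^sup>2)"
        unfolding bilW by (intro sum.cong refl) (simp add: h_def Dg_def power2_eq_square)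
      finally show ?thesis .
    qed
    \<comment> \<open>Optimality along h identifies lam^2 with the right-hand side of
      \<open>key\<close> at x, whose left-hand side is lam.\<close>
    ultimately have "lam \<le> lam * lam" using key[of x] bilWV lam_def by simp
    then have lam1: "1 \<le> lam" using lam by simp
    have "(\<Sum>i\<in>W. (\<Sum>j\<in>W. M i j * a j) / a i * (x i)\<^sup>2) = 1"
      unfolding x(2)[symmetric] by (intro sum.cong refl) (use mvW WV in \<open>auto simp: Dg_def c_def\<close>)
    then have "(\<Sum>i\<in>W. \<Sum>j\<in>W. M i j * a i * a j * (x i / a i - x j / a j)\<^sup>2) = 2 * (1 - lam)"
      using dirichlet_identity[of W M a x, OF symW] a WV unfolding lam_def by force
    moreover have nn: "0 \<le> M i j * a i * a j * (x i / a i - x j / a j)\<^sup>2"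
      if "i \<in> W" "j \<in> W" for i j
      by (intro mult_nonneg_nonneg) (use that Mnn a WV in \<open>auto simp: less_imp_le subset_iff\<close>)
    ultimately have dir0: "(\<Sum>i\<in>W. \<Sum>j\<in>W. M i j * a i * a j * (x i / a i - x j / a j)\<^sup>2) = 0"
      using lam1 by (smt (verit, best) sum_nonneg)
    \<comment> \<open>All terms of the Dirichlet sum vanish, and the edge from i to
      \<open>hub\<close> has nonzero weight, so the ratio agrees at its two ends.\<close>
    have const: "x i / a i = x hub / a hub" if i: "i \<in> W" for i
    proof (cases "i = hub")
      case False
      have "c i \<noteq> 0" using i unfolding W_def by simp
      then have "\<exists>j\<in>V. M i j \<noteq> 0" unfolding c_def mv_def by (force intro: sum.neutral)
      then have Mio: "M i hub \<noteq> 0" using conn False i WV by blast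
      have "i \<in> V" using i WV by blast
      then have "M hub i \<noteq> 0" using Mio sym[OF hub] by simp
      then have oW: "hub \<in> W" using row0[of hub i] hub \<open>i \<in> V\<close> by blast
      have "(\<Sum>j\<in>W. M i j * a i * a j * (x i / a i - x j / a j)\<^sup>2) = 0"
        by (rule nonneg_sum_eq_zeroD[OF finW _ dir0 i]) (use nn in \<open>auto intro: sum_nonneg\<close>)
      then have "M i hub * a i * a hub * (x i / a i - x hub / a hub)\<^sup>2 = 0"
        using nonneg_sum_eq_zeroD[OF finW _ _ oW, of "\<lambda>j. M i j * a i * a j * (x i / a i - x j / a j)\<^sup>2"]
          nn[OF i] by blast
      then show ?thesis using Mio a[OF \<open>i \<in> V\<close>] a[OF hub] by simp
    qed simp
    define s where "s = x hub / a hub"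
    have xs: "x i = s * a i" if "i \<in> W" for i
      using const[OF that] a[of i] that WV unfolding s_def[symmetric] by (auto simp: divide_eq_eq W_def)
    have "0 = s * (\<Sum>i\<in>W. c i * a i)"
      using x(1) xs by (simp add: sum_distrib_left mult_ac)
    moreover have "W \<noteq> {}" using x(2) by force
    then have "0 < (\<Sum>i\<in>W. c i * a i)"
      using a by (intro sum_pos finW) (auto simp: W_def)
    ultimately have "s = 0" by simp
    then have "\<forall>i\<in>W. x i = 0" using xs by simp
    then show False using x(2) by simp
  qed
  show ?thesis
    by (rule hyperbolic_if_nonpos_on_hyperplane[where c = c, OF sym neg])
qed

section \<open>Symmetric multilinear forms\<close>

definition unit_vec :: "'v \<Rightarrow> 'v \<Rightarrow> real" where
  "unit_vec i = (\<lambda>j. if j = i then 1 else 0)"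

text \<open>\<open>expand\<close> speaks of the first slot, and \<open>perm\<close> carries it to
  every slot. One function on lists of all lengths avoids a degree parameter: fixing an argument
  just lengthens the list.\<close>

locale multilinear_form =
  fixes V :: "'v set" and G :: "('v \<Rightarrow> real) list \<Rightarrow> real"
  assumes finite_vars: "finite V"
    and perm: "mset us = mset vs \<Longrightarrow> G us = G vs"
    and expand: "G (x # us) = (\<Sum>i\<in>V. x i * G (unit_vec i # us))"
    and units_nonneg: "set I \<subseteq> V \<Longrightarrow> 0 \<le> G (map unit_vec I)"
begin

lemma expand2: "G (u # x # us) = (\<Sum>i\<in>V. x i * G (u # unit_vec i # us))"
proof -
  have "G (u # x # us) = G (x # u # us)" by (rule perm) simp
  also have "\<dots> = (\<Sum>i\<in>V. x i * G (unit_vec i # u # us))" by (rule expand)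
  also have "\<dots> = (\<Sum>i\<in>V. x i * G (u # unit_vec i # us))"
    by (intro sum.cong refl arg_cong2[where f = "(*)"] perm) simp
  finally show ?thesis .
qed

lemma expand3: "G (u # v # x # us) = (\<Sum>i\<in>V. x i * G (unit_vec i # u # v # us))"
proof -
  have "G (u # v # x # us) = G (x # u # v # us)" by (rule perm) simp
  then show ?thesis unfolding expand[of x] .
qed

lemma bil_eq: "bil V (\<lambda>i j. G (unit_vec i # unit_vec j # us)) x y = G (x # y # us)"
proof -
  have "G (x # y # us) = (\<Sum>i\<in>V. \<Sum>j\<in>V. x i * (y j * G (unit_vec i # unit_vec j # us)))"
    unfolding expand[of x] by (intro sum.cong refl) (simp only: expand2[of _ y] sum_distrib_left)
  then show ?thesis unfolding bil_def by (simp add: mult_ac)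
qed

text \<open>Expanding the first vector turns it into unit vectors, whose index is moved into
  \<open>I\<close>. The later inductions keep this split into vectors not yet expanded and indices
  already chosen.\<close>

lemma nonneg:
  assumes "\<And>v i. v \<in> set vs \<Longrightarrow> i \<in> V \<Longrightarrow> 0 \<le> v i" "set I \<subseteq> V"
  shows "0 \<le> G (vs @ map unit_vec I)"
  using assms
proof (induction vs arbitrary: I)
  case Nil
  then show ?case using units_nonneg by simp
next
  case (Cons v vs)
  have "G ((v # vs) @ map unit_vec I) = (\<Sum>i\<in>V. v i * G (vs @ map unit_vec (i # I)))"
    unfolding append_Cons expand[of v]
    by (intro sum.cong refl arg_cong2[where f = "(*)"] perm) simp
  also have "\<dots> \<ge> 0"
    using Cons.prems by (intro sum_nonneg mult_nonneg_nonneg Cons.IH) auto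
  finally show ?case .
qed

text \<open>Lifts adjacency to the hub from unit vectors to positive directions. A nonzero entry has
  a nonzero term in the expansion of \<open>v\<close>; a term of the same kind with
  \<open>hub\<close> in the second slot is nonzero too, and since all terms are nonnegative and all
  weights positive, nothing cancels it.\<close>

lemma hub_connected:
  assumes hub: "hub \<in> V"
    and conn: "\<And>I i j l. set I \<subseteq> V \<Longrightarrow> Suc (length I) = m \<Longrightarrow> i \<in> V \<Longrightarrow> j \<in> V \<Longrightarrow> l \<in> V \<Longrightarrow>
      i \<noteq> hub \<Longrightarrow> G (map unit_vec (i # j # l # I)) \<noteq> 0 \<Longrightarrow>
      \<exists>l'\<in>V. G (map unit_vec (i # hub # l' # I)) \<noteq> 0"
    and pos: "\<And>v i. v \<in> set vs \<Longrightarrow> i \<in> V \<Longrightarrow> 0 < v i"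
    and len: "length vs + length I = m" "vs \<noteq> []" and I: "set I \<subseteq> V"
    and i: "i \<in> V" "i \<noteq> hub" and j: "j \<in> V"
    and nz: "G (unit_vec i # unit_vec j # vs @ map unit_vec I) \<noteq> 0"
  shows "G (unit_vec i # unit_vec hub # vs @ map unit_vec I) \<noteq> 0"
  using pos len I nz
proof (induction vs arbitrary: I)
  case Nil
  then show ?case by simp
next
  case (Cons v vs)
  have vpos: "0 < v l" if "l \<in> V" for l using Cons.prems(1) that by simp
  have exp: "G (unit_vec i # unit_vec k # (v # vs) @ map unit_vec I) =
    (\<Sum>l\<in>V. v l * G (unit_vec i # unit_vec k # vs @ map unit_vec (l # I)))" for k
    unfolding append_Cons expand3[of _ _ v]
    by (intro sum.cong refl arg_cong2[where f = "(*)"] perm) simp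
  obtain l where l: "l \<in> V" "G (unit_vec i # unit_vec j # vs @ map unit_vec (l # I)) \<noteq> 0"
    using Cons.prems(5) unfolding exp by (metis (no_types, lifting) mult_zero_right sum.neutral)
  have "\<exists>l'\<in>V. G (unit_vec i # unit_vec hub # vs @ map unit_vec (l' # I)) \<noteq> 0"
  \<comment> \<open>At the last vector \<open>conn\<close> may replace l by another index l'. This
    is harmless because \<open>v\<close> gives positive weight to every index.\<close>
  proof (cases "vs = []")
    case True
    then show ?thesis using conn[of I i j l] l i j Cons.prems by simp
  next
    case False
    have "G (unit_vec i # unit_vec hub # vs @ map unit_vec (l # I)) \<noteq> 0"
      using False l Cons.prems by (intro Cons.IH) auto
    then show ?thesis using l by blast
  qed
  then obtain l' where l': "l' \<in> V"
    "G (unit_vec i # unit_vec hub # vs @ map unit_vec (l' # I)) \<noteq> 0" by blast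
  have nn: "0 \<le> G (unit_vec i # unit_vec hub # vs @ map unit_vec (l # I))" if "l \<in> V" for l
  proof -
    have "0 \<le> G (vs @ map unit_vec (i # hub # l # I))"
      using that i hub Cons.prems by (intro nonneg) (auto simp: less_imp_le)
    also have "\<dots> = G (unit_vec i # unit_vec hub # vs @ map unit_vec (l # I))"
      by (rule perm) simp
    finally show ?thesis .
  qed
  show ?case unfolding exp
  proof
    assume "(\<Sum>l\<in>V. v l * G (unit_vec i # unit_vec hub # vs @ map unit_vec (l # I))) = 0"
    then have "v l' * G (unit_vec i # unit_vec hub # vs @ map unit_vec (l' # I)) = 0"
      by (intro nonneg_sum_eq_zeroD[OF finite_vars _ _ l'(1),
            of "\<lambda>l. v l * G (unit_vec i # unit_vec hub # vs @ map unit_vec (l # I))"])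
        (use nn vpos in \<open>auto simp: less_imp_le\<close>)
    then show False using l' vpos[OF l'(1)] by simp
  qed
qed

text \<open>Each vector of \<open>vs\<close> is the weight vector of one trickle-down step. The
  slices are obtained by replacing it with a unit vector, and the induction hypothesis covers them
  with the new index stored in \<open>I\<close>.\<close>

theorem hyperbolic_positive:
  assumes hub: "hub \<in> V"
    and base: "\<And>I. set I \<subseteq> V \<Longrightarrow> length I = m \<Longrightarrow>
      hyperbolic V (\<lambda>i j. G (map unit_vec (i # j # I)))"
    and conn: "\<And>I i j l. set I \<subseteq> V \<Longrightarrow> Suc (length I) = m \<Longrightarrow> i \<in> V \<Longrightarrow> j \<in> V \<Longrightarrow> l \<in> V \<Longrightarrow>
      i \<noteq> hub \<Longrightarrow> G (map unit_vec (i # j # l # I)) \<noteq> 0 \<Longrightarrow>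
      \<exists>l'\<in>V. G (map unit_vec (i # hub # l' # I)) \<noteq> 0"
    and pos: "\<And>v i. v \<in> set vs \<Longrightarrow> i \<in> V \<Longrightarrow> 0 < v i"
    and len: "length vs + length I = m" and I: "set I \<subseteq> V"
  shows "hyperbolic V (\<lambda>i j. G (unit_vec i # unit_vec j # vs @ map unit_vec I))"
  using pos len I
proof (induction vs arbitrary: I)
  case Nil
  then show ?case using base[of I] by simp
next
  case (Cons v vs)
  show ?case
  proof (rule hyperbolic_weighted_sum[OF finite_vars hub, where a = v and
        T = "\<lambda>k i j. G (unit_vec k # unit_vec i # unit_vec j # vs @ map unit_vec I)"])
    show "0 < v i" if "i \<in> V" for i using Cons.prems that by simp
    show "0 \<le> G (unit_vec k # unit_vec i # unit_vec j # vs @ map unit_vec I)"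
      if "k \<in> V" "i \<in> V" "j \<in> V" for k i j
    proof -
      have "0 \<le> G (vs @ map unit_vec (k # i # j # I))"
        using that Cons.prems by (intro nonneg) (auto simp: less_imp_le)
      also have "\<dots> = G (unit_vec k # unit_vec i # unit_vec j # vs @ map unit_vec I)"
        by (rule perm) simp
      finally show ?thesis .
    qed
    show "G (unit_vec i # unit_vec j # unit_vec k # vs @ map unit_vec I) =
        G (unit_vec j # unit_vec i # unit_vec k # vs @ map unit_vec I)" for i j k
      by (rule perm) simp
    show "G (unit_vec i # unit_vec j # unit_vec k # vs @ map unit_vec I) =
        G (unit_vec i # unit_vec k # unit_vec j # vs @ map unit_vec I)" for i j k
      by (rule perm) simp
    show "hyperbolic V (\<lambda>j k. G (unit_vec i # unit_vec j # unit_vec k # vs @ map unit_vec I))"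
      if i: "i \<in> V" for i
    proof -
      have "hyperbolic V (\<lambda>j k. G (unit_vec j # unit_vec k # vs @ map unit_vec (i # I)))"
        using i Cons.prems by (intro Cons.IH) auto
      moreover have "G (unit_vec j # unit_vec k # vs @ map unit_vec (i # I)) =
          G (unit_vec i # unit_vec j # unit_vec k # vs @ map unit_vec I)" for j k
        by (rule perm) simp
      ultimately show ?thesis by simp
    qed
    show "G (unit_vec i # unit_vec j # (v # vs) @ map unit_vec I) =
        (\<Sum>k\<in>V. v k * G (unit_vec k # unit_vec i # unit_vec j # vs @ map unit_vec I))" for i j
      unfolding append_Cons by (rule expand3)
    show "G (unit_vec i # unit_vec hub # (v # vs) @ map unit_vec I) \<noteq> 0"
      if "i \<in> V" "j \<in> V" "i \<noteq> hub" "G (unit_vec i # unit_vec j # (v # vs) @ map unit_vec I) \<noteq> 0"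
      for i j
      using that Cons.prems by (intro hub_connected[where m = m, OF hub conn]) auto
  qed
qed

lemma tendsto_shift:
  "((\<lambda>e. G (ws @ map (\<lambda>v i. v i + e) vs)) \<longlongrightarrow> G (ws @ vs)) (at_right 0)"
proof (induction vs arbitrary: ws)
  case (Cons v vs)
  have exp: "G (ws @ (\<lambda>i. v i + e) # us) = (\<Sum>i\<in>V. (v i + e) * G ((unit_vec i # ws) @ us))" for e us
  proof -
    have "G (ws @ (\<lambda>i. v i + e) # us) = G ((\<lambda>i. v i + e) # ws @ us)" by (rule perm) simp
    then show ?thesis by (simp add: expand[of "\<lambda>i. v i + e"])
  qed
  have "((\<lambda>e. \<Sum>i\<in>V. (v i + e) * G ((unit_vec i # ws) @ map (\<lambda>v i. v i + e) vs)) \<longlongrightarrow>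
      (\<Sum>i\<in>V. (v i + 0) * G ((unit_vec i # ws) @ vs))) (at_right 0)"
    by (intro tendsto_sum tendsto_mult tendsto_add tendsto_const tendsto_ident_at Cons.IH)
  then show ?case using exp exp[of 0 vs] by simp
qed simp

text \<open>The directions are shifted by e > 0 to become positive, and the inequality passes to the
  limit. The guard of \<open>hyperbolic\<close> must hold for every e, not only in the limit; this
  is why \<open>y\<close> is taken in the orthant, while \<open>x\<close> stays arbitrary.\<close>

theorem alexandrov_fenchel:
  assumes hub: "hub \<in> V"
    and base: "\<And>I. set I \<subseteq> V \<Longrightarrow> length I = m \<Longrightarrow>
      hyperbolic V (\<lambda>i j. G (map unit_vec (i # j # I)))"
    and conn: "\<And>I i j l. set I \<subseteq> V \<Longrightarrow> Suc (length I) = m \<Longrightarrow> i \<in> V \<Longrightarrow> j \<in> V \<Longrightarrow> l \<in> V \<Longrightarrow>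
      i \<noteq> hub \<Longrightarrow> G (map unit_vec (i # j # l # I)) \<noteq> 0 \<Longrightarrow>
      \<exists>l'\<in>V. G (map unit_vec (i # hub # l' # I)) \<noteq> 0"
    and nn: "\<And>v i. v \<in> set vs \<Longrightarrow> i \<in> V \<Longrightarrow> 0 \<le> v i" "\<And>i. i \<in> V \<Longrightarrow> 0 \<le> y i"
    and len: "length vs = m"
  shows "G (x # x # vs) * G (y # y # vs) \<le> (G (x # y # vs))\<^sup>2"
proof -
  define sh where "sh e = map (\<lambda>v i. v i + e) vs" for e :: real
  have lim: "((\<lambda>e. G (u # w # sh e)) \<longlongrightarrow> G (u # w # vs)) (at_right 0)" for u w
    using tendsto_shift[of "[u, w]" vs] unfolding sh_def by simp
  have le: "G (x # x # sh e) * G (y # y # sh e) \<le> (G (x # y # sh e))\<^sup>2" if e: "0 < e" for e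
  proof -
    have pos: "0 < v i" if "v \<in> set (sh e)" "i \<in> V" for v i
      using that nn e unfolding sh_def by (auto intro: add_nonneg_pos)
    have "hyperbolic V (\<lambda>i j. G (unit_vec i # unit_vec j # sh e @ map unit_vec []))"
      by (rule hyperbolic_positive[where m = m and hub = hub])
        (fact hub | rule base; assumption | rule conn; assumption | rule pos; assumption
          | simp add: len sh_def)+
    then have hyp: "0 \<le> G (b # b # sh e) \<Longrightarrow>
        G (a # a # sh e) * G (b # b # sh e) \<le> (G (a # b # sh e))\<^sup>2" for a b
      unfolding hyperbolic_def by (simp add: bil_eq)
    have "0 \<le> G ((y # y # sh e) @ map unit_vec [])"
      using nn pos by (intro nonneg) (auto simp: less_imp_le)
    then show ?thesis by (intro hyp) simp
  qed
  show ?thesis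
  proof (rule tendsto_le)
    show "((\<lambda>e. G (x # x # sh e) * G (y # y # sh e)) \<longlongrightarrow> G (x # x # vs) * G (y # y # vs))
        (at_right 0)"
      by (intro tendsto_mult lim)
    show "((\<lambda>e. (G (x # y # sh e))\<^sup>2) \<longlongrightarrow> (G (x # y # vs))\<^sup>2) (at_right 0)"
      by (intro tendsto_power lim)
    show "\<forall>\<^sub>F e in at_right 0. G (x # x # sh e) * G (y # y # sh e) \<le> (G (x # y # sh e))\<^sup>2"
      using le eventually_at_right_less[of "0 :: real"] by (rule eventually_mono[rotated])
  qed simp
qed

end

section \<open>Derivatives of polynomials\<close>

lemma lookup_Const_mult:
  fixes p :: "'v mpoly"
  shows "Poly_Mapping.lookup (Const c * p) m = c * Poly_Mapping.lookup p m"
  unfolding Const_def mult_map_scale_conv_mult[symmetric]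
  by (simp add: Poly_Mapping.map.rep_eq when_def)

lemma lookup_partial_deriv:
  "Poly_Mapping.lookup (partial_deriv i p) m = real (Poly_Mapping.lookup m i + 1) * Poly_Mapping.lookup p (m + Poly_Mapping.single i 1)"
proof -
  let ?e = "Poly_Mapping.single i (1 :: nat)"
  have "Poly_Mapping.lookup (partial_deriv i p) m =
      (\<Sum>k\<in>Poly_Mapping.keys p. real (Poly_Mapping.lookup k i) * Poly_Mapping.lookup p k when k - ?e = m)"
    unfolding partial_deriv_def by (simp add: lookup_sum lookup_single when_def)
  also have "\<dots> = (\<Sum>k\<in>Poly_Mapping.keys p. if k = m + ?e then real (Poly_Mapping.lookup k i) * Poly_Mapping.lookup p k else 0)"
  proof (intro sum.cong refl)
    fix k
    show "(real (Poly_Mapping.lookup k i) * Poly_Mapping.lookup p k when k - ?e = m) =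
        (if k = m + ?e then real (Poly_Mapping.lookup k i) * Poly_Mapping.lookup p k else 0)"
    \<comment> \<open>Subtraction of exponents truncates, so it can be undone only when i occurs in
      k. Otherwise the factor \<open>lookup k i\<close> removes the term.\<close>
    proof (cases "Poly_Mapping.lookup k i = 0")
      case False
      have "k - ?e = m \<longleftrightarrow> k = m + ?e"
      proof
        assume m: "k - ?e = m"
        show "k = m + ?e" unfolding m[symmetric]
          by (rule poly_mapping_eqI)
            (use False in \<open>auto simp: lookup_add lookup_minus lookup_single when_def\<close>)
      qed simp
      then show ?thesis by (simp add: when_def)
    qed (auto simp: lookup_add when_def)
  qed
  also have "\<dots> = real (Poly_Mapping.lookup m i + 1) * Poly_Mapping.lookup p (m + ?e)"
    by (simp add: sum.delta lookup_add in_keys_iff)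
  finally show ?thesis .
qed

lemma lookup_dir_deriv:
  "Poly_Mapping.lookup (dir_deriv V a p) m =
    (\<Sum>i\<in>V. a i * (real (Poly_Mapping.lookup m i + 1) * Poly_Mapping.lookup p (m + Poly_Mapping.single i 1)))"
  unfolding dir_deriv_def by (simp only: lookup_sum lookup_Const_mult lookup_partial_deriv)

lemma lookup_dir_deriv_unit_vec:
  assumes "finite V" "i \<in> V"
  shows "Poly_Mapping.lookup (dir_deriv V (unit_vec i) p) m =
    real (Poly_Mapping.lookup m i + 1) * Poly_Mapping.lookup p (m + Poly_Mapping.single i 1)"
proof -
  have "Poly_Mapping.lookup (dir_deriv V (unit_vec i) p) m = (\<Sum>j\<in>V. if j = i then
      real (Poly_Mapping.lookup m j + 1) * Poly_Mapping.lookup p (m + Poly_Mapping.single j 1) else 0)"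
    unfolding lookup_dir_deriv by (intro sum.cong refl) (simp add: unit_vec_def)
  then show ?thesis using assms by simp
qed

lemma dir_deriv_commute: "dir_deriv V a (dir_deriv V b p) = dir_deriv V b (dir_deriv V a p)"
proof (rule poly_mapping_eqI)
  fix m
  let ?e = "\<lambda>i. Poly_Mapping.single i (1 :: nat)"
  \<comment> \<open>The coefficient of m in the second partial derivative with respect to i and
    j.\<close>
  define F where "F i j = real (Poly_Mapping.lookup m i + 1) * (real (Poly_Mapping.lookup (m + ?e i) j + 1) * Poly_Mapping.lookup p (m + ?e i + ?e j))" for i j
  have F: "F i j = F j i" for i j
    by (cases "i = j") (auto simp: F_def lookup_add lookup_single ac_simps)
  have exp: "Poly_Mapping.lookup (dir_deriv V a (dir_deriv V b p)) m = (\<Sum>i\<in>V. \<Sum>j\<in>V. a i * b j * F i j)" for a b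
    unfolding lookup_dir_deriv sum_distrib_left F_def by (intro sum.cong refl) simp
  have "Poly_Mapping.lookup (dir_deriv V a (dir_deriv V b p)) m = (\<Sum>j\<in>V. \<Sum>i\<in>V. a i * b j * F i j)"
    unfolding exp by (rule sum.swap)
  also have "\<dots> = (\<Sum>j\<in>V. \<Sum>i\<in>V. b j * a i * F j i)"
    by (intro sum.cong refl) (simp add: F)
  finally show "Poly_Mapping.lookup (dir_deriv V a (dir_deriv V b p)) m = Poly_Mapping.lookup (dir_deriv V b (dir_deriv V a p)) m"
    unfolding exp .
qed

lemma foldr_dir_deriv_mset:
  assumes "mset us = mset vs"
  shows "foldr (dir_deriv V) us p = foldr (dir_deriv V) vs p"
proof -
  have "fold (dir_deriv V) (rev us) = fold (dir_deriv V) (rev vs)"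
    by (rule fold_multiset_equiv) (use assms in \<open>auto simp: fun_eq_iff dir_deriv_commute\<close>)
  then show ?thesis by (simp add: foldr_conv_fold)
qed

definition nonneg_coeffs :: "'v mpoly \<Rightarrow> bool" where
  "nonneg_coeffs p \<longleftrightarrow> (\<forall>m. 0 \<le> Poly_Mapping.lookup p m)"

lemma nonneg_coeffs_dir_deriv:
  assumes "nonneg_coeffs p" "a \<in> nonneg_orthant V"
  shows "nonneg_coeffs (dir_deriv V a p)"
  using assms unfolding nonneg_coeffs_def lookup_dir_deriv nonneg_orthant_def
  by (intro allI sum_nonneg mult_nonneg_nonneg) auto

lemma nonneg_coeffs_foldr:
  assumes "nonneg_coeffs p" "set as \<subseteq> nonneg_orthant V"
  shows "nonneg_coeffs (foldr (dir_deriv V) as p)"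
  using assms by (induction as) (auto intro: nonneg_coeffs_dir_deriv)

section \<open>Homogeneity\<close>

text \<open>The zero polynomial is homogeneous of every degree, so derivatives need no case
  distinction on whether they vanish.\<close>

definition homogeneous :: "'v set \<Rightarrow> nat \<Rightarrow> 'v mpoly \<Rightarrow> bool" where
  "homogeneous V d p \<longleftrightarrow> (\<forall>m\<in>Poly_Mapping.keys p. Poly_Mapping.keys m \<subseteq> V \<and> (\<Sum>i\<in>V. Poly_Mapping.lookup m i) = d)"

lemma keys_dir_derivE:
  assumes "m \<in> Poly_Mapping.keys (dir_deriv V a p)"
  obtains i where "i \<in> V" "m + Poly_Mapping.single i 1 \<in> Poly_Mapping.keys p"
proof -
  have "\<exists>i\<in>V. a i * (real (Poly_Mapping.lookup m i + 1) * Poly_Mapping.lookup p (m + Poly_Mapping.single i 1)) \<noteq> 0"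
    using assms unfolding in_keys_iff lookup_dir_deriv by (metis (no_types, lifting) sum.neutral)
  then show ?thesis using that by (auto simp: in_keys_iff)
qed

lemma sum_lookup_add_single:
  assumes "finite V" "i \<in> V"
  shows "(\<Sum>j\<in>V. Poly_Mapping.lookup (m + Poly_Mapping.single i (1 :: nat)) j) = Suc (\<Sum>j\<in>V. Poly_Mapping.lookup m j)"
  using assms by (simp add: lookup_add sum.distrib lookup_single when_def)

lemma keys_add_single: "Poly_Mapping.keys m \<subseteq> Poly_Mapping.keys (m + Poly_Mapping.single i (1 :: nat))"
  by (auto simp: in_keys_iff lookup_add)

lemma homogeneous_dir_deriv:
  assumes "finite V" "homogeneous V (Suc d) p"
  shows "homogeneous V d (dir_deriv V a p)"
  unfolding homogeneous_def
proof
  fix m assume "m \<in> Poly_Mapping.keys (dir_deriv V a p)"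
  then obtain i where i: "i \<in> V" "m + Poly_Mapping.single i 1 \<in> Poly_Mapping.keys p" by (rule keys_dir_derivE)
  then show "Poly_Mapping.keys m \<subseteq> V \<and> (\<Sum>i\<in>V. Poly_Mapping.lookup m i) = d"
    using assms(2) keys_add_single[of m i] sum_lookup_add_single[OF assms(1) i(1), of m]
    unfolding homogeneous_def by fastforce
qed

lemma dir_deriv_homogeneous_0:
  assumes "finite V" "homogeneous V 0 p"
  shows "dir_deriv V a p = 0"
proof -
  have "m \<notin> Poly_Mapping.keys (dir_deriv V a p)" for m
  proof
    assume "m \<in> Poly_Mapping.keys (dir_deriv V a p)"
    then obtain i where i: "i \<in> V" "m + Poly_Mapping.single i 1 \<in> Poly_Mapping.keys p" by (rule keys_dir_derivE)
    then show False
      using assms(2) sum_lookup_add_single[OF assms(1) i(1), of m] unfolding homogeneous_def by force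
  qed
  then show ?thesis by (metis ex_in_conv keys_eq_empty)
qed

text \<open>Valid also for d = 0, where the subtraction truncates: the derivative of a constant is
  zero, hence homogeneous of degree 0.\<close>

lemma homogeneous_dir_deriv_pred:
  assumes "finite V" "homogeneous V d p"
  shows "homogeneous V (d - 1) (dir_deriv V a p)"
proof (cases d)
  case 0
  then show ?thesis using assms dir_deriv_homogeneous_0[of V p a] by (simp add: homogeneous_def)
next
  case (Suc k)
  then show ?thesis using assms homogeneous_dir_deriv[of V k p a] by simp
qed

lemma homogeneous_foldr:
  assumes "finite V" "homogeneous V d p"
  shows "homogeneous V (d - length as) (foldr (dir_deriv V) as p)"
proof (induction as)
  case (Cons a as)
  then show ?case using homogeneous_dir_deriv_pred[OF assms(1) Cons] by (simp add: diff_diff_left)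
qed (use assms in simp)

section \<open>Evaluation\<close>

lemma eval_add: "eval_mpoly x (p + q) = eval_mpoly x p + eval_mpoly x q"
  unfolding eval_mpoly_def
  by (rule setsum_keys_plus_distrib
      [where f = "\<lambda>m c. c * (\<Prod>i\<in>Poly_Mapping.keys m. x i ^ Poly_Mapping.lookup m i)"]) (simp_all add: distrib_right)

lemma eval_zero: "eval_mpoly x 0 = 0"
  by (simp add: eval_mpoly_def)

lemma eval_sum: "eval_mpoly x (\<Sum>k\<in>A. F k) = (\<Sum>k\<in>A. eval_mpoly x (F k))"
  by (induction A rule: infinite_finite_induct) (auto simp: eval_add eval_zero)

lemma eval_single:
  "eval_mpoly x (Poly_Mapping.single m c) = c * (\<Prod>i\<in>Poly_Mapping.keys m. x i ^ Poly_Mapping.lookup m i)"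
  by (simp add: eval_mpoly_def)

lemma eval_Const_mult: "eval_mpoly x (Const c * p) = c * eval_mpoly x p"
proof -
  have "eval_mpoly x (Const c * p) =
      (\<Sum>m\<in>Poly_Mapping.keys p. Poly_Mapping.lookup (Const c * p) m * (\<Prod>i\<in>Poly_Mapping.keys m. x i ^ Poly_Mapping.lookup m i))"
    unfolding eval_mpoly_def
    by (rule sum.mono_neutral_left) (auto simp: in_keys_iff lookup_Const_mult)
  then show ?thesis
    unfolding lookup_Const_mult by (simp only: eval_mpoly_def sum_distrib_left mult.assoc)
qed

text \<open>The product runs over the fixed set \<open>V\<close> rather than over the support of m,
  which shrinks under differentiation.\<close>

definition monom_eval :: "'v set \<Rightarrow> ('v \<Rightarrow> real) \<Rightarrow> ('v \<Rightarrow>\<^sub>0 nat) \<Rightarrow> real" where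
  "monom_eval V x m = (\<Prod>i\<in>V. x i ^ Poly_Mapping.lookup m i)"

lemma monom_eval_eq:
  assumes "finite V" "Poly_Mapping.keys m \<subseteq> V"
  shows "(\<Prod>i\<in>Poly_Mapping.keys m. x i ^ Poly_Mapping.lookup m i) = monom_eval V x m"
  unfolding monom_eval_def
  by (rule prod.mono_neutral_left) (use assms in \<open>auto simp: in_keys_iff\<close>)

lemma eval_homogeneous:
  assumes "finite V" "homogeneous V d p"
  shows "eval_mpoly x p = (\<Sum>m\<in>Poly_Mapping.keys p. Poly_Mapping.lookup p m * monom_eval V x m)"
  unfolding eval_mpoly_def
  by (intro sum.cong refl arg_cong2[where f = "(*)"] monom_eval_eq)
    (use assms in \<open>auto simp: homogeneous_def\<close>)

lemma monom_eval_minus_single: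
  assumes "finite V" "i \<in> V"
  shows "monom_eval V x (m - Poly_Mapping.single i 1) =
    x i ^ (Poly_Mapping.lookup m i - 1) * (\<Prod>j\<in>V - {i}. x j ^ Poly_Mapping.lookup m j)"
  unfolding monom_eval_def prod.remove[OF assms]
  by (intro arg_cong2[where f = "(*)"] prod.cong) (auto simp: lookup_minus lookup_single)

lemma eval_dir_deriv:
  assumes V: "finite V" and hom: "homogeneous V d p"
  shows "eval_mpoly x (dir_deriv V a p) = (\<Sum>m\<in>Poly_Mapping.keys p. Poly_Mapping.lookup p m *
    (\<Sum>i\<in>V. a i * (real (Poly_Mapping.lookup m i) * monom_eval V x (m - Poly_Mapping.single i 1))))"
proof -
  have keys: "Poly_Mapping.keys (m - Poly_Mapping.single i 1) \<subseteq> V" if "m \<in> Poly_Mapping.keys p" for m i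
    using that hom unfolding homogeneous_def by (fastforce simp: in_keys_iff lookup_minus)
  have "eval_mpoly x (dir_deriv V a p) =
      (\<Sum>i\<in>V. \<Sum>m\<in>Poly_Mapping.keys p. a i * (real (Poly_Mapping.lookup m i) * Poly_Mapping.lookup p m *
         monom_eval V x (m - Poly_Mapping.single i 1)))"
    unfolding dir_deriv_def partial_deriv_def eval_sum eval_Const_mult eval_single sum_distrib_left
    by (intro sum.cong refl) (simp add: monom_eval_eq[OF V keys] del: One_nat_def)
  also have "\<dots> = (\<Sum>m\<in>Poly_Mapping.keys p. \<Sum>i\<in>V. a i * (real (Poly_Mapping.lookup m i) * Poly_Mapping.lookup p m *
         monom_eval V x (m - Poly_Mapping.single i 1)))"
    by (rule sum.swap)
  finally show ?thesis by (simp add: sum_distrib_left mult_ac)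
qed

lemma eval_line_has_derivative:
  assumes V: "finite V" and hom: "homogeneous V d p"
    and z: "\<And>i. i \<in> V \<Longrightarrow> ((\<lambda>t. z t i) has_field_derivative a i) (at s)"
  shows "((\<lambda>t. eval_mpoly (z t) p) has_field_derivative eval_mpoly (z s) (dir_deriv V a p)) (at s)"
proof -
  have "((\<lambda>t. monom_eval V (z t) m) has_field_derivative
      (\<Sum>i\<in>V. (real (Poly_Mapping.lookup m i) * (a i * z s i ^ (Poly_Mapping.lookup m i - 1))) *
        (\<Prod>j\<in>V - {i}. z s j ^ Poly_Mapping.lookup m j))) (at s)" for m
    unfolding monom_eval_def
    by (rule has_field_derivative_prod, drule z) (auto intro!: derivative_eq_intros)
  moreover have "(\<Sum>i\<in>V. (real (Poly_Mapping.lookup m i) * (a i * z s i ^ (Poly_Mapping.lookup m i - 1))) *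
        (\<Prod>j\<in>V - {i}. z s j ^ Poly_Mapping.lookup m j)) =
      (\<Sum>i\<in>V. a i * (real (Poly_Mapping.lookup m i) * monom_eval V (z s) (m - Poly_Mapping.single i 1)))" for m
    by (intro sum.cong refl) (simp add: monom_eval_minus_single[OF V] mult_ac del: One_nat_def)
  ultimately have "((\<lambda>t. monom_eval V (z t) m) has_field_derivative
      (\<Sum>i\<in>V. a i * (real (Poly_Mapping.lookup m i) * monom_eval V (z s) (m - Poly_Mapping.single i 1)))) (at s)" for m
    by simp
  then show ?thesis
    unfolding eval_homogeneous[OF V hom] eval_dir_deriv[OF V hom]
    by (intro DERIV_sum DERIV_cmult)
qed

lemma euler_identity:
  assumes V: "finite V" and hom: "homogeneous V d p"
  shows "eval_mpoly x (dir_deriv V x p) = real d * eval_mpoly x p"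
proof -
  have "(\<Sum>i\<in>V. x i * (real (Poly_Mapping.lookup m i) * monom_eval V x (m - Poly_Mapping.single i 1))) =
      real d * monom_eval V x m" if "m \<in> Poly_Mapping.keys p" for m
  proof -
    have "x i * (real (Poly_Mapping.lookup m i) * monom_eval V x (m - Poly_Mapping.single i 1)) =
        real (Poly_Mapping.lookup m i) * monom_eval V x m" if i: "i \<in> V" for i
    proof (cases "Poly_Mapping.lookup m i")
      case (Suc k)
      then show ?thesis unfolding monom_eval_minus_single[OF V i]
        by (simp add: monom_eval_def prod.remove[OF V i])
    qed simp
    then have "(\<Sum>i\<in>V. x i * (real (Poly_Mapping.lookup m i) * monom_eval V x (m - Poly_Mapping.single i 1))) =
        (\<Sum>i\<in>V. real (Poly_Mapping.lookup m i) * monom_eval V x m)"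
      by (intro sum.cong refl)
    also have "\<dots> = real (\<Sum>i\<in>V. Poly_Mapping.lookup m i) * monom_eval V x m"
      by (simp add: sum_distrib_right)
    finally have "(\<Sum>i\<in>V. x i * (real (Poly_Mapping.lookup m i) * monom_eval V x (m - Poly_Mapping.single i 1))) =
        real (\<Sum>i\<in>V. Poly_Mapping.lookup m i) * monom_eval V x m" .
    then show ?thesis using hom that unfolding homogeneous_def by simp
  qed
  then show ?thesis
    unfolding eval_dir_deriv[OF V hom] eval_homogeneous[OF V hom]
    by (simp add: sum_distrib_left mult_ac)
qed

lemma eval_homogeneous_0:
  assumes V: "finite V" and hom: "homogeneous V 0 p"
  shows "eval_mpoly x p = Poly_Mapping.lookup p 0"
proof -
  have "m = 0" if "m \<in> Poly_Mapping.keys p" for m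
  proof (rule poly_mapping_eqI)
    fix i
    have "Poly_Mapping.keys m \<subseteq> V" "\<forall>j\<in>V. Poly_Mapping.lookup m j = 0" using that hom V unfolding homogeneous_def by auto
    then show "Poly_Mapping.lookup m i = Poly_Mapping.lookup 0 i" by (auto simp: in_keys_iff subset_iff)
  qed
  then have "Poly_Mapping.keys p \<subseteq> {0}" by auto
  then have "eval_mpoly x p = (\<Sum>m\<in>{0}. Poly_Mapping.lookup p m * (\<Prod>i\<in>Poly_Mapping.keys m. x i ^ Poly_Mapping.lookup m i))"
    unfolding eval_mpoly_def by (intro sum.mono_neutral_left) (auto simp: in_keys_iff)
  then show ?thesis by simp
qed

text \<open>Euler's identity iterated d times. It translates values of derivatives into values of
  the multilinear form with the evaluation point repeated.\<close>

lemma fact_eval_homogeneous: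
  assumes V: "finite V" and hom: "homogeneous V d p"
  shows "fact d * eval_mpoly x p = Poly_Mapping.lookup (foldr (dir_deriv V) (replicate d x) p) 0"
  using hom
proof (induction d arbitrary: p)
  case 0
  then show ?case using eval_homogeneous_0[OF V] by simp
next
  case (Suc d)
  have "fact (Suc d) * eval_mpoly x p = fact d * eval_mpoly x (dir_deriv V x p)"
    using euler_identity[OF V Suc.prems] by simp
  also have "\<dots> = Poly_Mapping.lookup (foldr (dir_deriv V) (replicate d x @ [x]) p) 0"
    using Suc.IH[OF homogeneous_dir_deriv[OF V Suc.prems], of x] by simp
  finally show ?case by (simp add: replicate_append_same)
qed

lemma monom_eval_nonneg: "x \<in> nonneg_orthant V \<Longrightarrow> 0 \<le> monom_eval V x m"
  unfolding monom_eval_def nonneg_orthant_def by (intro prod_nonneg) auto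

lemma eval_nonneg:
  assumes "finite V" "homogeneous V d p" "nonneg_coeffs p" "x \<in> nonneg_orthant V"
  shows "0 \<le> eval_mpoly x p"
  unfolding eval_homogeneous[OF assms(1,2)]
  by (intro sum_nonneg mult_nonneg_nonneg monom_eval_nonneg assms)
    (use assms(3) in \<open>auto simp: nonneg_coeffs_def\<close>)

text \<open>A monomial of positive coefficient that is nonzero at \<open>x\<close> uses only
  variables that are positive there, so it stays positive at \<open>z\<close>, and no other term is
  negative.\<close>

lemma eval_pos_mono_support:
  assumes V: "finite V" and hom: "homogeneous V d p" and nn: "nonneg_coeffs p"
    and x: "x \<in> nonneg_orthant V" and pos: "0 < eval_mpoly x p"
    and z: "z \<in> nonneg_orthant V" and xz: "\<And>i. i \<in> V \<Longrightarrow> 0 < x i \<Longrightarrow> 0 < z i"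
  shows "0 < eval_mpoly z p"
proof -
  obtain m where m: "m \<in> Poly_Mapping.keys p" "Poly_Mapping.lookup p m * monom_eval V x m \<noteq> 0"
    using pos sum.neutral[of "Poly_Mapping.keys p" "\<lambda>m. Poly_Mapping.lookup p m * monom_eval V x m"]
    unfolding eval_homogeneous[OF V hom] by fastforce
  have xnz: "x i ^ Poly_Mapping.lookup m i \<noteq> 0" if "i \<in> V" for i
    using m(2) V that unfolding monom_eval_def by (auto simp: prod_zero_iff)
  have "0 < z i ^ Poly_Mapping.lookup m i" if i: "i \<in> V" for i
  proof (cases "Poly_Mapping.lookup m i = 0")
    case False
    then have "x i \<noteq> 0" using xnz[OF i] by auto
    then have "0 < x i" using x i unfolding nonneg_orthant_def by (auto simp: less_le)
    then show ?thesis using xz[OF i] by simp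
  qed simp
  then have "0 < monom_eval V z m" unfolding monom_eval_def by (intro prod_pos) auto
  moreover have "0 < Poly_Mapping.lookup p m" using m nn unfolding nonneg_coeffs_def by (metis less_le mult_zero_left)
  ultimately have "0 < Poly_Mapping.lookup p m * monom_eval V z m" by simp
  also have "\<dots> \<le> eval_mpoly z p"
    unfolding eval_homogeneous[OF V hom]
    by (rule member_le_sum)
      (use m nn z in \<open>auto intro!: mult_nonneg_nonneg monom_eval_nonneg simp: nonneg_coeffs_def\<close>)
  finally show ?thesis .
qed

section \<open>From the Alexandrov--Fenchel inequality to log-concavity\<close>

text \<open>Along a segment with values phi, the second derivative of ln phi is (phi'' phi - phi'^2)
  / phi^2. The inequality is required for \<open>v\<close> of arbitrary signs because
  \<open>v\<close> is the difference of the endpoints.\<close>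

lemma log_concave_if_second_deriv:
  fixes p :: "'v mpoly"
  assumes V: "finite V" and hom: "homogeneous V d p" and nn: "nonneg_coeffs p"
    and ineq: "\<And>x v. x \<in> nonneg_orthant V \<Longrightarrow>
      eval_mpoly x (dir_deriv V v (dir_deriv V v p)) * eval_mpoly x p
        \<le> (eval_mpoly x (dir_deriv V v p))\<^sup>2"
  shows "log_concave V p"
  unfolding log_concave_def
proof (intro conjI ballI)
  show "0 \<le> eval_mpoly x p" if "x \<in> nonneg_orthant V" for x
    using eval_nonneg[OF V hom nn that] .
next
  fix x y t
  assume x: "x \<in> nonneg_orthant V" and y: "y \<in> nonneg_orthant V" and t: "t \<in> {0..1 :: real}"
  define z where "z = (\<lambda>s i. (1 - s) * x i + s * y i)"
  define v where "v = (\<lambda>i. y i - x i)"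
  define \<phi> where "\<phi> s = eval_mpoly (z s) p" for s
  have z01: "z 0 = x" "z 1 = y" unfolding z_def by auto
  have zn: "z s \<in> nonneg_orthant V" if "s \<in> {0..1}" for s
    using x y that unfolding z_def nonneg_orthant_def by auto
  have nn\<phi>: "0 \<le> \<phi> s" if "s \<in> {0..1}" for s
    unfolding \<phi>_def by (rule eval_nonneg[OF V hom nn zn[OF that]])
  have "ereal (1 - t) * elog (\<phi> 0) + ereal t * elog (\<phi> 1) \<le> elog (\<phi> t)"
  \<comment> \<open>At t = 0 and t = 1 the extended-real convention that 0 times minus infinity is 0
    decides. For t strictly between, a zero at an endpoint makes the left-hand side minus
    infinity.\<close>
  proof (cases "t = 0 \<or> t = 1")
    case True
    then show ?thesis by (auto simp: zero_ereal_def[symmetric] one_ereal_def[symmetric])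
  next
    case False
    then have t01: "0 < t" "t < 1" using t by auto
    show ?thesis
    proof (cases "\<phi> 0 = 0 \<or> \<phi> 1 = 0")
      case True
      then show ?thesis using t01 by (auto simp: elog_def)
    next
      case False
      then have pos01: "0 < \<phi> 0" "0 < \<phi> 1" using nn\<phi>[of 0] nn\<phi>[of 1] by auto
      \<comment> \<open>For s < 1 the point z s is positive wherever x is, so the logarithm is
        finite on the whole segment, boundary points of the orthant included.\<close>
      have pos: "0 < \<phi> s" if s: "s \<in> {0..1}" for s
      proof (cases "s = 1")
        case False
        then have "s < 1" using s by simp
        show ?thesis unfolding \<phi>_def
        proof (rule eval_pos_mono_support[OF V hom nn x _ zn[OF s]])
          show "0 < eval_mpoly x p" using pos01 z01 unfolding \<phi>_def by simp
          show "0 < z s i" if "i \<in> V" "0 < x i" for i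
            using that y s \<open>s < 1\<close> unfolding z_def nonneg_orthant_def by (auto intro: add_pos_nonneg)
        qed
      qed (use pos01 in simp)
      define \<phi>1 where "\<phi>1 s = eval_mpoly (z s) (dir_deriv V v p)" for s
      define \<phi>2 where "\<phi>2 s = eval_mpoly (z s) (dir_deriv V v (dir_deriv V v p))" for s
      have dz: "((\<lambda>t. z t i) has_field_derivative v i) (at s)" for i s
        unfolding z_def v_def by (auto intro!: derivative_eq_intros)
      have d1: "(\<phi> has_field_derivative \<phi>1 s) (at s)" for s
        unfolding \<phi>_def \<phi>1_def by (rule eval_line_has_derivative[OF V hom dz])
      have d2: "(\<phi>1 has_field_derivative \<phi>2 s) (at s)" for s
        unfolding \<phi>1_def \<phi>2_def
        by (rule eval_line_has_derivative[OF V homogeneous_dir_deriv_pred[OF V hom] dz])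
      have conc: "concave_on {0..1} (\<lambda>s. ln (\<phi> s))"
      proof (rule f''_le0_imp_concave)
        fix s :: real assume s: "s \<in> {0..1}"
        show "((\<lambda>s. ln (\<phi> s)) has_field_derivative \<phi>1 s / \<phi> s) (at s)"
          using pos[OF s] by (auto intro!: derivative_eq_intros d1)
        show "((\<lambda>s. \<phi>1 s / \<phi> s) has_field_derivative
            (\<phi>2 s * \<phi> s - \<phi>1 s * \<phi>1 s) / (\<phi> s * \<phi> s)) (at s)"
          using pos[OF s] by (intro DERIV_divide d1 d2) simp
        show "(\<phi>2 s * \<phi> s - \<phi>1 s * \<phi>1 s) / (\<phi> s * \<phi> s) \<le> 0"
          using ineq[OF zn[OF s], of v] unfolding \<phi>_def \<phi>1_def \<phi>2_def
          by (intro divide_nonpos_nonneg) (auto simp: power2_eq_square)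
      qed simp
      have "(1 - t) * ln (\<phi> 0) + t * ln (\<phi> 1) \<le> ln (\<phi> t)"
        using concave_onD[OF conc, of t 0 1] t01 by simp
      then show ?thesis using pos[of t] pos01 t01 by (simp add: elog_def)
    qed
  qed
  then show "ereal (1 - t) * elog (eval_mpoly x p) + ereal t * elog (eval_mpoly y p)
      \<le> elog (eval_mpoly (\<lambda>i. (1 - t) * x i + t * y i) p)"
    unfolding \<phi>_def z01 unfolding z_def .
qed

text \<open>For p homogeneous of degree \<open>length us\<close> the iterated derivative is a
  constant, and this is d! times the usual polarization. Taking the constant coefficient keeps the
  form multilinear on lists of every length.\<close>

definition polarization :: "'v set \<Rightarrow> 'v mpoly \<Rightarrow> ('v \<Rightarrow> real) list \<Rightarrow> real" where
  "polarization V p us = Poly_Mapping.lookup (foldr (dir_deriv V) us p) 0"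

lemma multilinear_form_polarization:
  assumes V: "finite V" and nn: "nonneg_coeffs p"
  shows "multilinear_form V (polarization V p)"
proof
  show "polarization V p us = polarization V p vs" if "mset us = mset vs" for us vs
    unfolding polarization_def foldr_dir_deriv_mset[OF that] ..
  show "polarization V p (x # us) = (\<Sum>i\<in>V. x i * polarization V p (unit_vec i # us))" for x us
    unfolding polarization_def foldr_Cons comp_def lookup_dir_deriv[of V x]
    by (intro sum.cong refl) (simp add: lookup_dir_deriv_unit_vec[OF V])
  show "0 \<le> polarization V p (map unit_vec I)" if "set I \<subseteq> V" for I
  proof -
    have "set (map unit_vec I) \<subseteq> nonneg_orthant V" by (auto simp: nonneg_orthant_def unit_vec_def)
    from nonneg_coeffs_foldr[OF nn this] show ?thesis
      unfolding polarization_def nonneg_coeffs_def by blast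
  qed
qed fact

text \<open>If r is the derivative in the directions \<open>as\<close>, of degree k + 2, then r and
  its first two derivatives along v, evaluated at x, are values of the polarization with x filling
  all remaining slots. The inequality for the pair v, x is the one to be shown, up to
  factorials.\<close>

lemma completely_log_concave_if_alexandrov_fenchel:
  fixes p :: "'v mpoly"
  assumes V: "finite V" and hom: "homogeneous V d p" and nn: "nonneg_coeffs p"
    and af: "\<And>vs x y. length vs + 2 = d \<Longrightarrow> set vs \<subseteq> nonneg_orthant V \<Longrightarrow> y \<in> nonneg_orthant V \<Longrightarrow>
      polarization V p (x # x # vs) * polarization V p (y # y # vs) \<le> (polarization V p (x # y # vs))\<^sup>2"
  shows "completely_log_concave V p"
  unfolding completely_log_concave_def
proof (intro allI impI)
  fix as assume as: "set as \<subseteq> nonneg_orthant V"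
  define r where "r = foldr (dir_deriv V) as p"
  define e where "e = d - length as"
  have homr: "homogeneous V e r" unfolding r_def e_def by (rule homogeneous_foldr[OF V hom])
  show "log_concave V (foldr (dir_deriv V) as p)"
    unfolding r_def[symmetric]
  proof (rule log_concave_if_second_deriv[OF V homr])
    show "nonneg_coeffs r" unfolding r_def by (rule nonneg_coeffs_foldr[OF nn as])
    fix x v assume x: "x \<in> nonneg_orthant V"
    have hom1: "homogeneous V (e - 1) (dir_deriv V v r)"
      by (rule homogeneous_dir_deriv_pred[OF V homr])
    show "eval_mpoly x (dir_deriv V v (dir_deriv V v r)) * eval_mpoly x r
        \<le> (eval_mpoly x (dir_deriv V v r))\<^sup>2"
    proof (cases "e \<le> 1")
      case True
      then have "dir_deriv V v (dir_deriv V v r) = 0"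
        using dir_deriv_homogeneous_0[OF V] hom1 by simp
      then show ?thesis by (simp add: eval_zero)
    next
      case False
      then have "e = Suc (Suc (e - 2))" by simp
      then obtain k where k: "e = Suc (Suc k)" by blast
      define ws where "ws = replicate k x @ as"
      have ws: "length ws + 2 = d" "set ws \<subseteq> nonneg_orthant V"
        using k as x unfolding ws_def e_def by auto
      have hom2: "homogeneous V k (dir_deriv V v (dir_deriv V v r))"
        using homogeneous_dir_deriv_pred[OF V hom1] k by simp
      have p0: "fact (Suc (Suc k)) * eval_mpoly x r = polarization V p (x # x # ws)"
        using fact_eval_homogeneous[OF V homr, of x] unfolding polarization_def ws_def k r_def
        by simp
      have "fact (Suc k) * eval_mpoly x (dir_deriv V v r) = polarization V p (replicate (Suc k) x @ v # as)"
        using fact_eval_homogeneous[OF V hom1, of x] unfolding polarization_def k r_def by simp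
      also have "\<dots> = polarization V p (v # x # ws)"
        unfolding polarization_def ws_def by (intro arg_cong2[where f = Poly_Mapping.lookup] foldr_dir_deriv_mset) simp_all
      finally have p1: "fact (Suc k) * eval_mpoly x (dir_deriv V v r) = polarization V p (v # x # ws)" .
      have "fact k * eval_mpoly x (dir_deriv V v (dir_deriv V v r)) =
          polarization V p (replicate k x @ v # v # as)"
        using fact_eval_homogeneous[OF V hom2, of x] unfolding polarization_def r_def by simp
      also have "\<dots> = polarization V p (v # v # ws)"
        unfolding polarization_def ws_def by (intro arg_cong2[where f = Poly_Mapping.lookup] foldr_dir_deriv_mset) simp_all
      finally have p2: "fact k * eval_mpoly x (dir_deriv V v (dir_deriv V v r)) =
          polarization V p (v # v # ws)" .
      define P0 P1 P2 where "P0 = eval_mpoly x r" and "P1 = eval_mpoly x (dir_deriv V v r)"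
        and "P2 = eval_mpoly x (dir_deriv V v (dir_deriv V v r))"
      define F where "F = (fact k :: real)"
      have F: "0 < F" unfolding F_def by simp
      \<comment> \<open>After cancelling factorials the Alexandrov-Fenchel inequality reads (k+2) P2
        P0 <= (k+1) P1^2. This is sharper than log-concavity, which follows on enlarging k + 1 to k
        + 2.\<close>
      have "(F * P2) * ((real k + 2) * ((real k + 1) * F) * P0) \<le> ((real k + 1) * F * P1)\<^sup>2"
        using af[OF ws x, of v] unfolding p0[symmetric] p1[symmetric] p2[symmetric] P0_def P1_def P2_def F_def
        by (simp add: algebra_simps)
      then have "F\<^sup>2 * (real k + 1) * ((real k + 2) * (P2 * P0)) \<le> F\<^sup>2 * (real k + 1) * ((real k + 1) * P1\<^sup>2)"
        by (simp add: power2_eq_square algebra_simps)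
      then have "(real k + 2) * (P2 * P0) \<le> (real k + 1) * P1\<^sup>2"
        using F by (simp add: mult_le_cancel_left_pos)
      also have "\<dots> \<le> (real k + 2) * P1\<^sup>2" by (intro mult_right_mono) auto
      finally have "P2 * P0 \<le> P1\<^sup>2" by (simp add: mult_le_cancel_left_pos)
      then show ?thesis unfolding P0_def P1_def P2_def .
    qed
  qed
qed

section \<open>Polarization on unit vectors\<close>

definition list_exponent :: "'v list \<Rightarrow> 'v \<Rightarrow>\<^sub>0 nat" where
  "list_exponent I = sum_list (map (\<lambda>i. Poly_Mapping.single i 1) I)"

lemma lookup_list_exponent: "Poly_Mapping.lookup (list_exponent I) i = count_list I i"
  by (induction I) (auto simp: list_exponent_def lookup_add lookup_single)

text \<open>The successive exponent factors telescope, for each variable, to a rising factorial,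
  written as a quotient of two factorials.\<close>

lemma lookup_foldr_dir_deriv_units:
  assumes V: "finite V" and "set I \<subseteq> V"
  shows "Poly_Mapping.lookup (foldr (dir_deriv V) (map unit_vec I) p) m =
    (\<Prod>i\<in>V. fact (Poly_Mapping.lookup m i + count_list I i) / fact (Poly_Mapping.lookup m i)) *
      Poly_Mapping.lookup p (m + list_exponent I)"
  using assms(2)
proof (induction I arbitrary: m)
  case Nil
  then show ?case by (simp add: list_exponent_def)
next
  case (Cons i I)
  let ?m' = "m + Poly_Mapping.single i (1 :: nat)"
  let ?F = "\<lambda>m I. \<Prod>j\<in>V. fact (Poly_Mapping.lookup m j + count_list I j) / (fact (Poly_Mapping.lookup m j) :: real)"
  have i: "i \<in> V" using Cons.prems by simp
  have "(real (Poly_Mapping.lookup m i) + 1) * ?F ?m' I = ?F m (i # I)"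
  proof -
    have "(\<Prod>j\<in>V - {i}. fact (Poly_Mapping.lookup ?m' j + count_list I j) / (fact (Poly_Mapping.lookup ?m' j) :: real)) =
      (\<Prod>j\<in>V - {i}. fact (Poly_Mapping.lookup m j + count_list (i # I) j) / fact (Poly_Mapping.lookup m j))"
      by (intro prod.cong refl) (auto simp: lookup_add lookup_single)
    moreover have "(real (Poly_Mapping.lookup m i) + 1) *
        (fact (Poly_Mapping.lookup ?m' i + count_list I i) / fact (Poly_Mapping.lookup ?m' i)) =
        fact (Poly_Mapping.lookup m i + count_list (i # I) i) / (fact (Poly_Mapping.lookup m i) :: real)"
    proof -
      have cancel: "(r + 1) * (x / ((1 + r) * y)) = x / y" if "0 \<le> r" for r x y :: real
        using that by (simp add: add.commute)
      show ?thesis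
        using cancel[of "real (Poly_Mapping.lookup m i)"
            "fact (Poly_Mapping.lookup m i + count_list (i # I) i)" "fact (Poly_Mapping.lookup m i)"]
        by (simp add: lookup_add)
    qed
    ultimately show ?thesis unfolding prod.remove[OF V i] by (simp only: mult.assoc[symmetric])
  qed
  moreover have "Poly_Mapping.lookup (foldr (dir_deriv V) (map unit_vec (i # I)) p) m =
      (real (Poly_Mapping.lookup m i) + 1) * (?F ?m' I * Poly_Mapping.lookup p (?m' + list_exponent I))"
    unfolding list.map foldr_Cons comp_def lookup_dir_deriv_unit_vec[OF V i]
    using Cons by (simp del: One_nat_def)
  ultimately show ?case by (simp only: mult.assoc[symmetric]) (simp add: list_exponent_def add.assoc)
qed

section \<open>The polynomial of a set function\<close>

definition q_exponent :: "nat \<Rightarrow> nat set \<Rightarrow> nat \<Rightarrow>\<^sub>0 nat" where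
  "q_exponent n S = Poly_Mapping.single 0 (n + 1 - card S) + (\<Sum>j\<in>S. Poly_Mapping.single j 1)"

lemma lookup_q_exponent:
  assumes "S \<subseteq> {1..n}"
  shows "Poly_Mapping.lookup (q_exponent n S) i =
    (if i = 0 then n + 1 - card S else if i \<in> S then 1 else 0)"
proof -
  have "finite S" using assms finite_subset by blast
  moreover have "0 \<notin> S" using assms by auto
  ultimately show ?thesis
    unfolding q_exponent_def by (auto simp: lookup_add lookup_sum lookup_single when_def)
qed

lemma q_exponent_inj:
  assumes "S \<subseteq> {1..n}" "T \<subseteq> {1..n}" "q_exponent n S = q_exponent n T"
  shows "S = T"
proof -
  have "S = {i. i \<noteq> 0 \<and> Poly_Mapping.lookup (q_exponent n S) i \<noteq> 0}"
    using assms(1) unfolding lookup_q_exponent[OF assms(1)] by auto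
  also have "\<dots> = T"
    using assms(2) unfolding assms(3) lookup_q_exponent[OF assms(2)] by auto
  finally show ?thesis .
qed

lemma Var_power: "Var i ^ k = Poly_Mapping.single (Poly_Mapping.single i k) 1"
  by (induction k) (auto simp: Var_def mult_single single_add[symmetric])

lemma prod_Var: "(\<Prod>j\<in>S. Var j) = Poly_Mapping.single (\<Sum>j\<in>S. Poly_Mapping.single j 1) 1"
  by (induction S rule: infinite_finite_induct) (auto simp: Var_def mult_single)

lemma q_poly_eq: "q_poly n f = (\<Sum>S\<in>Pow {1..n}. Poly_Mapping.single (q_exponent n S) (f S))"
proof -
  have "q_poly n f = (\<Sum>i\<in>{0..n}. \<Sum>S\<in>{S \<in> Pow {1..n}. card S = i}. Poly_Mapping.single (q_exponent n S) (f S))"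
    unfolding q_poly_def sum_distrib_left
    by (intro sum.cong refl)
      (auto simp: Var_power prod_Var Const_def mult_single q_exponent_def)
  also have "\<dots> = (\<Sum>S\<in>Pow {1..n}. Poly_Mapping.single (q_exponent n S) (f S))"
  proof (rule sum.group)
    show "card ` Pow {1..n} \<subseteq> {0..n}"
      using card_mono[of "{1..n}"] by auto
  qed simp_all
  finally show ?thesis .
qed

lemma lookup_q_poly:
  "Poly_Mapping.lookup (q_poly n f) m = (\<Sum>S\<in>Pow {1..n}. if q_exponent n S = m then f S else 0)"
  unfolding q_poly_eq by (simp add: lookup_sum lookup_single when_def)

lemma lookup_q_poly_exponent:
  assumes "T \<subseteq> {1..n}"
  shows "Poly_Mapping.lookup (q_poly n f) (q_exponent n T) = f T"
proof -
  have "Poly_Mapping.lookup (q_poly n f) (q_exponent n T) = (\<Sum>S\<in>Pow {1..n}. if S = T then f S else 0)"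
    unfolding lookup_q_poly by (intro sum.cong refl) (use q_exponent_inj assms in auto)
  then show ?thesis using assms by simp
qed

lemma keys_q_polyE:
  assumes "m \<in> Poly_Mapping.keys (q_poly n f)"
  obtains S where "S \<subseteq> {1..n}" "m = q_exponent n S"
proof -
  from assms have "(\<Sum>S\<in>Pow {1..n}. if q_exponent n S = m then f S else 0) \<noteq> 0"
    unfolding in_keys_iff lookup_q_poly .
  then obtain S where "S \<in> Pow {1..n}" "(if q_exponent n S = m then f S else 0) \<noteq> 0"
    by (rule sum.not_neutral_contains_not_neutral)
  then show ?thesis using that by (auto split: if_splits)
qed

lemma homogeneous_q_poly: "homogeneous {0..n} (n + 1) (q_poly n f)"
  unfolding homogeneous_def
proof
  fix m assume "m \<in> Poly_Mapping.keys (q_poly n f)"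
  then obtain S where S: "S \<subseteq> {1..n}" "m = q_exponent n S" by (rule keys_q_polyE)
  have "card S \<le> n" using card_mono[OF _ S(1)] by simp
  have "(\<Sum>i\<in>{0..n}. Poly_Mapping.lookup m i) = (n + 1 - card S) + (\<Sum>i\<in>{1..n}. if i \<in> S then 1 else 0)"
    unfolding S(2) lookup_q_exponent[OF S(1)]
    by (subst sum.atLeast_Suc_atMost) (auto intro!: sum.cong)
  also have "(\<Sum>i\<in>{1..n}. if i \<in> S then 1 else 0 :: nat) = card S"
    using S(1) by (simp add: sum.If_cases Int_absorb1)
  finally have "(\<Sum>i\<in>{0..n}. Poly_Mapping.lookup m i) = n + 1" using \<open>card S \<le> n\<close> by simp
  moreover have "Poly_Mapping.keys m \<subseteq> {0..n}"
    using S by (auto simp: in_keys_iff lookup_q_exponent subset_iff split: if_splits)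
  ultimately show "Poly_Mapping.keys m \<subseteq> {0..n} \<and> (\<Sum>i\<in>{0..n}. Poly_Mapping.lookup m i) = n + 1" by simp
qed

lemma nonneg_coeffs_q_poly:
  assumes "\<And>S. S \<subseteq> {1..n} \<Longrightarrow> 0 \<le> f S"
  shows "nonneg_coeffs (q_poly n f)"
  unfolding nonneg_coeffs_def lookup_q_poly using assms by (auto intro!: sum_nonneg)

text \<open>Index 0 stands for y and may repeat; any other index may occur once, since the
  polynomial has degree at most 1 in each x.\<close>

abbreviation simple_list :: "nat list \<Rightarrow> bool" where
  "simple_list I \<equiv> distinct (filter (\<lambda>i. i \<noteq> 0) I)"

lemma length_eq_count_0: "length I = count_list I 0 + length (filter (\<lambda>i. i \<noteq> 0) I)"
  by (induction I) auto

lemma card_simple_list: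
  assumes "simple_list I"
  shows "length I = count_list I 0 + card (set I - {0})"
proof -
  have "set I - {0} = set (filter (\<lambda>i. i \<noteq> 0) I)" by auto
  then show ?thesis using length_eq_count_0[of I] distinct_card[OF assms] by simp
qed

lemma count_simple_list:
  "simple_list I \<Longrightarrow> i \<noteq> 0 \<Longrightarrow> count_list I i = (if i \<in> set I then 1 else 0)"
  by (induction I) (auto split: if_splits)

lemma not_simple_listE:
  assumes "\<not> simple_list I"
  obtains i where "i \<noteq> 0" "2 \<le> count_list I i"
proof -
  have "\<exists>i. i \<noteq> 0 \<and> 2 \<le> count_list I i"
    using assms
  proof (induction I)
    case (Cons a I)
    show ?case
    proof (cases "simple_list I")
      case True
      then have "a \<noteq> 0" "a \<in> set I" using Cons.prems by (auto split: if_splits)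
      then show ?thesis using count_simple_list[OF True, of a] by (intro exI[of _ a]) simp
    next
      case False
      then obtain i where "i \<noteq> 0" "2 \<le> count_list I i" using Cons.IH by blast
      then show ?thesis by (intro exI[of _ i]) simp
    qed
  qed simp
  then show ?thesis using that by blast
qed

text \<open>A simple list of length n + 1 with x-indices S contains 0 exactly n + 1 - |S| times,
  which is the exponent of y attached to S. Only y contributes a nontrivial factorial.\<close>

lemma polarization_q_poly:
  assumes len: "length I = n + 1" and I: "set I \<subseteq> {0..n}"
  shows "polarization {0..n} (q_poly n f) (map unit_vec I) =
    (if simple_list I then fact (count_list I 0) * f (set I - {0}) else 0)"
proof -
  have eq: "polarization {0..n} (q_poly n f) (map unit_vec I) =
      (\<Prod>i\<in>{0..n}. fact (count_list I i)) * Poly_Mapping.lookup (q_poly n f) (list_exponent I)"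
    unfolding polarization_def using lookup_foldr_dir_deriv_units[OF _ I, of "q_poly n f" 0] by simp
  show ?thesis
  proof (cases "simple_list I")
    case True
    let ?S = "set I - {0}"
    have S: "?S \<subseteq> {1..n}" using I by auto
    have "list_exponent I = q_exponent n ?S"
    proof (rule poly_mapping_eqI)
      fix i
      show "Poly_Mapping.lookup (list_exponent I) i = Poly_Mapping.lookup (q_exponent n ?S) i"
        unfolding lookup_q_exponent[OF S] lookup_list_exponent
        using card_simple_list[OF True] count_simple_list[OF True, of i] len by auto
    qed
    then have "Poly_Mapping.lookup (q_poly n f) (list_exponent I) = f ?S"
      using lookup_q_poly_exponent[OF S] by simp
    moreover have "(\<Prod>i\<in>{0..n}. fact (count_list I i) :: real) = fact (count_list I 0)"
    proof -
      have "(\<Prod>i\<in>{0..n}. fact (count_list I i) :: real) =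
          (\<Prod>i\<in>{0..n}. if i = 0 then fact (count_list I 0) else 1)"
        by (intro prod.cong refl) (use count_simple_list[OF True] in auto)
      then show ?thesis by simp
    qed
    ultimately show ?thesis using eq True by simp
  next
    case False
    then obtain i where i: "i \<noteq> 0" "2 \<le> count_list I i" by (rule not_simple_listE)
    have "list_exponent I \<notin> Poly_Mapping.keys (q_poly n f)"
    proof
      assume "list_exponent I \<in> Poly_Mapping.keys (q_poly n f)"
      then obtain S where S: "S \<subseteq> {1..n}" "list_exponent I = q_exponent n S" by (rule keys_q_polyE)
      then have "count_list I i \<le> 1"
        using lookup_q_exponent[OF S(1), of i] i(1) lookup_list_exponent[of I i] by (simp split: if_splits)
      then show False using i by simp
    qed
    then show ?thesis using eq False by (simp add: in_keys_iff)
  qed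
qed

section \<open>Coverage functions\<close>

text \<open>Inclusion-exclusion for two sets, written with indicators. The formula for pairs
  includes i = j because an indicator equals its square, so \<open>{i, i}\<close> needs no separate
  treatment in double sums.\<close>

lemma coverage_functionE:
  assumes "coverage_function V g"
  obtains U :: "nat set" and b w where "finite U" "\<And>u. u \<in> U \<Longrightarrow> 0 \<le> (w u :: real)"
    "\<And>i u. b i u \<in> {0, 1 :: real}"
    "\<And>i. i \<in> V \<Longrightarrow> g {i} = (\<Sum>u\<in>U. w u * b i u)"
    "\<And>i j. i \<in> V \<Longrightarrow> j \<in> V \<Longrightarrow> g {i, j} = (\<Sum>u\<in>U. w u * (b i u + b j u - b i u * b j u))"
proof -
  obtain U :: "nat set" and A w where U: "finite U" "\<forall>i\<in>V. A i \<subseteq> U" "\<forall>u\<in>U. 0 \<le> (w u :: real)"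
    and g: "\<forall>T\<subseteq>V. g T = (\<Sum>u\<in>(\<Union>i\<in>T. A i). w u)"
    using assms unfolding coverage_function_def by blast
  define b where "b i u = (if u \<in> A i then 1 else 0 :: real)" for i u
  have sum: "(\<Sum>u\<in>B. w u) = (\<Sum>u\<in>U. w u * (if u \<in> B then 1 else 0))" if "B \<subseteq> U" for B
  proof -
    have "(\<Sum>u\<in>B. w u) = (\<Sum>u\<in>U \<inter> B. w u)" using that by (simp add: Int_absorb1)
    then show ?thesis using U(1) by (simp add: sum.inter_restrict if_distrib cong: if_cong)
  qed
  have pair: "g {i, j} = (\<Sum>u\<in>U. w u * (b i u + b j u - b i u * b j u))" if "i \<in> V" "j \<in> V" for i j
  proof -
    have "g {i, j} = (\<Sum>u\<in>A i \<union> A j. w u)" using g that by simp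
    also have "\<dots> = (\<Sum>u\<in>U. w u * (if u \<in> A i \<union> A j then 1 else 0))" using U that by (intro sum) auto
    also have "\<dots> = (\<Sum>u\<in>U. w u * (b i u + b j u - b i u * b j u))"
      by (intro sum.cong refl) (auto simp: b_def)
    finally show ?thesis .
  qed
  have single: "g {i} = (\<Sum>u\<in>U. w u * b i u)" if "i \<in> V" for i
  proof -
    have "g {i} = (\<Sum>u\<in>U. w u * (b i u + b i u - b i u * b i u))" using pair[OF that that] by simp
    also have "\<dots> = (\<Sum>u\<in>U. w u * b i u)" by (intro sum.cong refl) (auto simp: b_def)
    finally show ?thesis .
  qed
  show ?thesis
  proof (rule that[OF U(1)])
    show "\<And>u. u \<in> U \<Longrightarrow> 0 \<le> w u" using U(3) by blast
    show "\<And>i u. b i u \<in> {0, 1}" by (simp add: b_def)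
  qed (fact single pair)+
qed

lemma coverage_singleton_nonneg:
  assumes "coverage_function V g" "i \<in> V"
  shows "0 \<le> g {i}"
proof (rule coverage_functionE[OF assms(1)])
  fix U :: "nat set" and w and b :: "'a \<Rightarrow> nat \<Rightarrow> real"
  assume w: "\<And>u. u \<in> U \<Longrightarrow> 0 \<le> w u" and b: "\<And>i u. b i u \<in> {0, 1}"
    and g1: "\<And>i. i \<in> V \<Longrightarrow> g {i} = (\<Sum>u\<in>U. w u * b i u)"
  have "0 \<le> b i u" for u using b[of i u] by auto
  then show ?thesis unfolding g1[OF assms(2)] by (intro sum_nonneg mult_nonneg_nonneg w)
qed

lemma coverage_pair_le:
  assumes "coverage_function V g" "i \<in> V" "j \<in> V"
  shows "g {i, j} \<le> g {i} + g {j}"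
proof (rule coverage_functionE[OF assms(1)])
  fix U :: "nat set" and w and b :: "'a \<Rightarrow> nat \<Rightarrow> real"
  assume w: "\<And>u. u \<in> U \<Longrightarrow> 0 \<le> w u" and b: "\<And>i u. b i u \<in> {0, 1}"
    and g1: "\<And>i. i \<in> V \<Longrightarrow> g {i} = (\<Sum>u\<in>U. w u * b i u)"
    and g2: "\<And>i j. i \<in> V \<Longrightarrow> j \<in> V \<Longrightarrow> g {i, j} = (\<Sum>u\<in>U. w u * (b i u + b j u - b i u * b j u))"
  have "b i u + b j u - b i u * b j u \<le> b i u + b j u" for u
    using b[of i u] b[of j u] by auto
  then show ?thesis
    unfolding g1[OF assms(2)] g1[OF assms(3)] g2[OF assms(2,3)] sum.distrib[symmetric] distrib_left[symmetric]
    by (intro sum_mono mult_left_mono w) auto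
qed

text \<open>
  A point u covered by the indices i with b i u = 1 contributes 2 X Y - Y^2 to the left-hand side,
  where X is the sum of all z i and Y that of the covered ones.
\<close>

lemma coverage_quadratic_le:
  assumes cov: "coverage_function V g" and fin: "finite V"
  shows "(\<Sum>i\<in>V. \<Sum>j\<in>V. g {i, j} * z i * z j) \<le> 2 * (\<Sum>i\<in>V. z i) * (\<Sum>i\<in>V. g {i} * z i)"
proof (rule coverage_functionE[OF cov])
  fix U :: "nat set" and w and b :: "'a \<Rightarrow> nat \<Rightarrow> real"
  assume w: "\<And>u. u \<in> U \<Longrightarrow> 0 \<le> w u"
    and g1: "\<And>i. i \<in> V \<Longrightarrow> g {i} = (\<Sum>u\<in>U. w u * b i u)"
    and g2: "\<And>i j. i \<in> V \<Longrightarrow> j \<in> V \<Longrightarrow> g {i, j} = (\<Sum>u\<in>U. w u * (b i u + b j u - b i u * b j u))"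
  define X where "X = (\<Sum>i\<in>V. z i)"
  define Y where "Y u = (\<Sum>i\<in>V. b i u * z i)" for u
  have quad: "(\<Sum>i\<in>V. \<Sum>j\<in>V. (b i u + b j u - b i u * b j u) * z i * z j) = 2 * X * Y u - (Y u)\<^sup>2" for u
  proof -
    have "(\<Sum>i\<in>V. \<Sum>j\<in>V. (b i u + b j u - b i u * b j u) * z i * z j) =
        (\<Sum>i\<in>V. \<Sum>j\<in>V. (b i u * z i) * z j) + (\<Sum>i\<in>V. \<Sum>j\<in>V. z i * (b j u * z j))
          - (\<Sum>i\<in>V. \<Sum>j\<in>V. (b i u * z i) * (b j u * z j))"
      unfolding sum.distrib[symmetric] sum_subtractf[symmetric]
      by (intro sum.cong refl) (simp add: algebra_simps)
    also have "\<dots> = Y u * X + X * Y u - Y u * Y u"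
      unfolding X_def Y_def sum_product ..
    finally show ?thesis by (simp add: power2_eq_square)
  qed
  have "(\<Sum>i\<in>V. \<Sum>j\<in>V. g {i, j} * z i * z j) =
      (\<Sum>i\<in>V. \<Sum>j\<in>V. \<Sum>u\<in>U. w u * ((b i u + b j u - b i u * b j u) * z i * z j))"
    by (intro sum.cong refl) (simp add: g2 sum_distrib_right mult.assoc)
  also have "\<dots> = (\<Sum>i\<in>V. \<Sum>u\<in>U. \<Sum>j\<in>V. w u * ((b i u + b j u - b i u * b j u) * z i * z j))"
    by (intro sum.cong refl sum.swap)
  also have "\<dots> = (\<Sum>u\<in>U. \<Sum>i\<in>V. \<Sum>j\<in>V. w u * ((b i u + b j u - b i u * b j u) * z i * z j))"
    by (rule sum.swap)
  also have "\<dots> = (\<Sum>u\<in>U. w u * (2 * X * Y u - (Y u)\<^sup>2))"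
    unfolding quad[symmetric] sum_distrib_left ..
  also have "\<dots> \<le> (\<Sum>u\<in>U. w u * (2 * X * Y u))"
    by (intro sum_mono mult_left_mono w) auto
  also have "\<dots> = 2 * X * (\<Sum>u\<in>U. \<Sum>i\<in>V. w u * b i u * z i)"
    by (simp add: Y_def sum_distrib_left mult_ac)
  also have "(\<Sum>u\<in>U. \<Sum>i\<in>V. w u * b i u * z i) = (\<Sum>i\<in>V. \<Sum>u\<in>U. w u * b i u * z i)"
    by (rule sum.swap)
  also have "\<dots> = (\<Sum>i\<in>V. g {i} * z i)"
    by (intro sum.cong refl) (simp add: g1 sum_distrib_right)
  finally show ?thesis unfolding X_def .
qed

lemma strongly_2_coverageE:
  assumes "strongly_2_coverage n f" "\<tau> \<subseteq> {1..n}" "card \<tau> + 2 \<le> n"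
  obtains g where "coverage_function ({1..n} - \<tau>) g"
    "\<And>i. i \<in> {1..n} - \<tau> \<Longrightarrow> f (insert i \<tau>) = g {i} + f \<tau>"
    "\<And>i j. i \<in> {1..n} - \<tau> \<Longrightarrow> j \<in> {1..n} - \<tau> \<Longrightarrow> i \<noteq> j \<Longrightarrow>
      f (insert i (insert j \<tau>)) = g {i, j} + f \<tau>"
proof -
  obtain g where cov: "coverage_function ({1..n} - \<tau>) g"
    and g: "\<And>T. T \<subseteq> {1..n} - \<tau> \<Longrightarrow> card T \<in> {1, 2} \<Longrightarrow> f (T \<union> \<tau>) = g T + f \<tau>"
    using assms unfolding strongly_2_coverage_def link_def by blast
  show ?thesis
  proof (rule that[OF cov])
    show "f (insert i \<tau>) = g {i} + f \<tau>" if "i \<in> {1..n} - \<tau>" for i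
      using g[of "{i}"] that by simp
    show "f (insert i (insert j \<tau>)) = g {i, j} + f \<tau>"
      if "i \<in> {1..n} - \<tau>" "j \<in> {1..n} - \<tau>" "i \<noteq> j" for i j
      using g[of "{i, j}"] that by simp
  qed
qed

section \<open>The quadratic derivatives\<close>

lemma bil_insert_0:
  fixes M :: "nat \<Rightarrow> nat \<Rightarrow> real"
  assumes V: "finite V" "insert 0 R \<subseteq> V" "0 \<notin> R"
    and sym: "\<And>i j. i \<in> V \<Longrightarrow> j \<in> V \<Longrightarrow> M i j = M j i"
    and zero: "\<And>i j. i \<in> V - insert 0 R \<Longrightarrow> j \<in> V \<Longrightarrow> M i j = 0"
  shows "bil V M z z = M 0 0 * (z 0)\<^sup>2 + 2 * z 0 * (\<Sum>i\<in>R. M 0 i * z i)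
    + (\<Sum>i\<in>R. \<Sum>j\<in>R. M i j * z i * z j)"
proof -
  have fin: "finite R" using finite_subset[OF V(2,1)] by simp
  have inner: "(\<Sum>j\<in>V. M i j * z i * z j) = M i 0 * z i * z 0 + (\<Sum>j\<in>R. M i j * z i * z j)"
    if i: "i \<in> V" for i
  proof -
    have "(\<Sum>j\<in>V. M i j * z i * z j) = (\<Sum>j\<in>insert 0 R. M i j * z i * z j)"
    proof (rule sum.mono_neutral_right[OF V(1,2)])
      show "\<forall>j\<in>V - insert 0 R. M i j * z i * z j = 0"
        using zero i sym[OF i] by auto
    qed
    then show ?thesis using fin V(3) by simp
  qed
  have "bil V M z z = (\<Sum>i\<in>insert 0 R. \<Sum>j\<in>V. M i j * z i * z j)"
    unfolding bil_def by (rule sum.mono_neutral_right[OF V(1,2)]) (use zero in auto)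
  also have "\<dots> = (\<Sum>i\<in>insert 0 R. M i 0 * z i * z 0 + (\<Sum>j\<in>R. M i j * z i * z j))"
    by (intro sum.cong refl inner) (use V(2) in blast)
  also have "\<dots> = M 0 0 * z 0 * z 0 + (\<Sum>j\<in>R. M 0 j * z 0 * z j)
      + (\<Sum>i\<in>R. M i 0 * z i * z 0) + (\<Sum>i\<in>R. \<Sum>j\<in>R. M i j * z i * z j)"
    using fin V(3) by (simp add: sum.distrib)
  also have "(\<Sum>i\<in>R. M i 0 * z i * z 0) = z 0 * (\<Sum>i\<in>R. M 0 i * z i)"
    unfolding sum_distrib_left
  proof (intro sum.cong refl)
    fix i assume "i \<in> R"
    then have "M i 0 = M 0 i" using V(2) by (intro sym) auto
    then show "M i 0 * z i * z 0 = z 0 * (M 0 i * z i)" by simp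
  qed
  also have "(\<Sum>j\<in>R. M 0 j * z 0 * z j) = z 0 * (\<Sum>i\<in>R. M 0 i * z i)"
    by (simp add: sum_distrib_left mult_ac)
  finally show ?thesis by (simp add: power2_eq_square)
qed

text \<open>Serves the case in which a single x-variable remains, where the set tau is too large for
  the coverage condition. The normal vector is row 0 of \<open>M\<close>: on vectors orthogonal to
  it the cross term is minus twice the term M 0 0 * (z 0)^2.\<close>

lemma hyperbolic_two_variables:
  fixes M :: "nat \<Rightarrow> nat \<Rightarrow> real"
  assumes V: "finite V" "{0, r} \<subseteq> V" "r \<noteq> 0"
    and sym: "\<And>i j. i \<in> V \<Longrightarrow> j \<in> V \<Longrightarrow> M i j = M j i"
    and zero: "\<And>i j. i \<in> V - {0, r} \<Longrightarrow> j \<in> V \<Longrightarrow> M i j = 0"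
    and rr: "M r r = 0" and nonneg: "0 \<le> M 0 0"
  shows "hyperbolic V M"
proof (rule hyperbolic_if_nonpos_on_hyperplane[where
      c = "\<lambda>i. if i = 0 then M 0 0 else if i = r then M 0 r else 0", OF sym])
  fix z :: "nat \<Rightarrow> real"
  assume "(\<Sum>i\<in>V. (if i = 0 then M 0 0 else if i = r then M 0 r else 0) * z i) = 0"
  moreover have "(\<Sum>i\<in>V. (if i = 0 then M 0 0 else if i = r then M 0 r else 0) * z i) =
      (\<Sum>i\<in>{0, r}. (if i = 0 then M 0 0 else if i = r then M 0 r else 0) * z i)"
    by (rule sum.mono_neutral_right) (use V in auto)
  ultimately have L: "M 0 r * z r = - (M 0 0 * z 0)" using V(3) by simp
  have "bil V M z z = M 0 0 * (z 0)\<^sup>2 + 2 * z 0 * (M 0 r * z r)"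
    using bil_insert_0[of V "{r}" M z, OF V(1) _ _ sym] V zero rr by simp
  also have "\<dots> = - (M 0 0 * (z 0)\<^sup>2)" unfolding L by (simp add: power2_eq_square)
  finally show "bil V M z z \<le> 0" using nonneg by simp
qed auto

text \<open>
  On the hyperplane where (k + 1) z 0 is minus the sum of the other coordinates, the covering
  part of the form is nonpositive, and the rest is a times X^2 / card R minus the sum of squares.
\<close>

lemma hyperbolic_coverage:
  fixes M :: "nat \<Rightarrow> nat \<Rightarrow> real"
  assumes V: "finite V" "insert 0 R \<subseteq> V" "0 \<notin> R" and cov: "coverage_function R g"
    and card: "card R = Suc k" and a: "0 \<le> a"
    and sym: "\<And>i j. i \<in> V \<Longrightarrow> j \<in> V \<Longrightarrow> M i j = M j i"
    and zero: "\<And>i j. i \<in> V - insert 0 R \<Longrightarrow> j \<in> V \<Longrightarrow> M i j = 0"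
    and M00: "M 0 0 = fact (k + 2) * a"
    and M0: "\<And>i. i \<in> R \<Longrightarrow> M 0 i = fact (k + 1) * (g {i} + a)"
    and Mii: "\<And>i. i \<in> R \<Longrightarrow> M i i = 0"
    and Mij: "\<And>i j. i \<in> R \<Longrightarrow> j \<in> R \<Longrightarrow> i \<noteq> j \<Longrightarrow> M i j = fact k * (g {i, j} + a)"
  shows "hyperbolic V M"
proof (rule hyperbolic_if_nonpos_on_hyperplane[where
      c = "\<lambda>i. if i = 0 then real k + 1 else if i \<in> R then 1 else 0", OF sym])
  fix z :: "nat \<Rightarrow> real"
  assume hp: "(\<Sum>i\<in>V. (if i = 0 then real k + 1 else if i \<in> R then 1 else 0) * z i) = 0"
  have fin: "finite R" using finite_subset[OF V(2,1)] by simp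
  define X where "X = (\<Sum>i\<in>R. z i)"
  define N where "N = (\<Sum>i\<in>R. (z i)\<^sup>2)"
  define S where "S = (\<Sum>i\<in>R. g {i} * z i)"
  define Q where "Q = (\<Sum>i\<in>R. \<Sum>j\<in>R. g {i, j} * z i * z j)"
  have "(\<Sum>i\<in>V. (if i = 0 then real k + 1 else if i \<in> R then 1 else 0) * z i) =
      (\<Sum>i\<in>insert 0 R. (if i = 0 then real k + 1 else if i \<in> R then 1 else 0) * z i)"
    by (rule sum.mono_neutral_right) (use V in auto)
  also have "\<dots> = (real k + 1) * z 0 + (\<Sum>i\<in>R. (if i = 0 then real k + 1 else if i \<in> R then 1 else 0) * z i)"
    using fin V(3) by simp
  also have "(\<Sum>i\<in>R. (if i = 0 then real k + 1 else if i \<in> R then 1 else 0) * z i) = X"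
    unfolding X_def by (intro sum.cong refl) (use V(3) in auto)
  \<comment> \<open>The normal vector is chosen so that the cross term 2 (k+1) z 0 * S becomes - 2 X
    S and cancels the upper bound 2 X S for the covering part Q.\<close>
  finally have L: "(real k + 1) * z 0 = - X" using hp by simp
  have lin: "(\<Sum>i\<in>R. M 0 i * z i) = fact k * (real k + 1) * (S + a * X)"
    unfolding S_def X_def sum_distrib_left sum.distrib[symmetric]
    by (intro sum.cong refl) (simp add: M0 algebra_simps)
  have "(\<Sum>i\<in>R. \<Sum>j\<in>R. M i j * z i * z j) \<le> fact k * (Q + a * X\<^sup>2 - a * N)"
  proof -
    have "(\<Sum>j\<in>R. M i j * z i * z j) \<le>
        fact k * ((\<Sum>j\<in>R. g {i, j} * z i * z j) + a * z i * X - a * (z i)\<^sup>2)" if i: "i \<in> R" for i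
    proof -
      have "(\<Sum>j\<in>R. M i j * z i * z j) = (\<Sum>j\<in>R - {i}. fact k * (g {i, j} + a) * z i * z j)"
        unfolding sum.remove[OF fin i] by (simp add: Mii[OF i]) (intro sum.cong refl, use Mij i in auto)
      also have "\<dots> = (\<Sum>j\<in>R. fact k * (g {i, j} + a) * z i * z j) - fact k * (g {i} + a) * (z i)\<^sup>2"
        unfolding sum.remove[OF fin i] by (simp add: power2_eq_square)
      also have "(\<Sum>j\<in>R. fact k * (g {i, j} + a) * z i * z j) =
          fact k * ((\<Sum>j\<in>R. g {i, j} * z i * z j) + a * z i * X)"
        unfolding X_def sum_distrib_left sum.distrib[symmetric]
        by (intro sum.cong refl) (simp add: algebra_simps)
      \<comment> \<open>Removing the diagonal costs (g {i} + a) (z i)^2. The share of g {i} is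
        nonnegative and may be dropped; the share of \<open>a\<close> is kept, as it supplies the
        sum of squares N.\<close>
      also have "\<dots> - fact k * (g {i} + a) * (z i)\<^sup>2 \<le>
          fact k * ((\<Sum>j\<in>R. g {i, j} * z i * z j) + a * z i * X - a * (z i)\<^sup>2)"
        using coverage_singleton_nonneg[OF cov i] by (simp add: algebra_simps)
      finally show ?thesis .
    qed
    then have "(\<Sum>i\<in>R. \<Sum>j\<in>R. M i j * z i * z j) \<le>
        (\<Sum>i\<in>R. fact k * ((\<Sum>j\<in>R. g {i, j} * z i * z j) + a * z i * X - a * (z i)\<^sup>2))"
      by (rule sum_mono)
    also have "\<dots> = fact k * (Q + a * X * X - a * N)"
      unfolding sum_distrib_left[symmetric] sum_subtractf sum.distrib Q_def N_def
      by (simp add: X_def sum_distrib_left sum_distrib_right mult_ac)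
    finally show ?thesis by (simp add: power2_eq_square mult.assoc)
  qed
  then have "bil V M z z \<le> fact k * (real k + 2) * (real k + 1) * a * (z 0)\<^sup>2
      + 2 * z 0 * (fact k * (real k + 1) * (S + a * X)) + fact k * (Q + a * X\<^sup>2 - a * N)"
    using bil_insert_0[of V R M z, OF V sym zero] lin M00 by (simp add: algebra_simps)
  also have "\<dots> = fact k * (a * (real k + 2) * z 0 * ((real k + 1) * z 0)
      + 2 * ((real k + 1) * z 0) * (S + a * X) + Q + a * X\<^sup>2 - a * N)"
    by (simp add: power2_eq_square algebra_simps)
  also have "\<dots> = fact k * ((Q - 2 * X * S) - a * ((real k + 2) * z 0 * X + X\<^sup>2 + N))"
    unfolding L by (simp add: power2_eq_square algebra_simps)
  also have "\<dots> \<le> 0"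
  proof (rule mult_nonneg_nonpos)
    have "0 \<le> (real k + 2) * z 0 * X + X\<^sup>2 + N"
    proof -
      \<comment> \<open>Multiplying by k + 1 allows z 0 to be eliminated by \<open>L\<close>. What
        remains is the Cauchy-Schwarz inequality for the k + 1 coordinates in
        \<open>R\<close>.\<close>
      have "(real k + 1) * ((real k + 2) * z 0 * X + X\<^sup>2 + N) =
          (real k + 2) * ((real k + 1) * z 0) * X + (real k + 1) * X\<^sup>2 + (real k + 1) * N"
        by (simp add: algebra_simps)
      also have "\<dots> = (real k + 1) * N - X\<^sup>2"
        unfolding L by (simp add: power2_eq_square algebra_simps)
      also have "\<dots> \<ge> 0"
        using sum_squared_le_sum_of_squares[of z R] card unfolding X_def N_def by (simp add: algebra_simps)
      finally show ?thesis by (simp add: zero_le_mult_iff)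
    qed
    moreover have "Q \<le> 2 * X * S"
      unfolding Q_def X_def S_def by (rule coverage_quadratic_le[OF cov fin])
    ultimately show "(Q - 2 * X * S) - a * ((real k + 2) * z 0 * X + X\<^sup>2 + N) \<le> 0"
      using mult_nonneg_nonneg[OF a] by fastforce
  qed simp
  finally show "bil V M z z \<le> 0" .
qed auto

lemma polarization_mset:
  assumes "mset I = mset J"
  shows "polarization V p (map unit_vec I) = polarization V p (map unit_vec J)"
  unfolding polarization_def
  by (intro arg_cong2[where f = Poly_Mapping.lookup] foldr_dir_deriv_mset) (simp_all add: assms)

text \<open>A list \<open>J\<close> repeating an x-index gives the zero form. Otherwise
  \<open>J\<close> consists of k zeros and a set \<open>\<tau>\<close> with k + |tau| = n - 1, and
  the form lives on y and the k + 1 variables outside \<open>\<tau>\<close>; it is the form of the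
  link at \<open>\<tau>\<close>.\<close>

lemma hyperbolic_q_poly_quadratic:
  assumes f: "\<And>S. S \<subseteq> {1..n} \<Longrightarrow> 0 \<le> f S" and cov: "strongly_2_coverage n f"
    and len: "length J + 1 = n" and J: "set J \<subseteq> {0..n}"
  shows "hyperbolic {0..n} (\<lambda>i j. polarization {0..n} (q_poly n f) (map unit_vec (i # j # J)))"
proof -
  define M where "M i j = polarization {0..n} (q_poly n f) (map unit_vec (i # j # J))" for i j
  have sym: "M i j = M j i" for i j
    unfolding M_def by (rule polarization_mset) simp
  have M: "M i j = (if simple_list (i # j # J) then
      fact (count_list (i # j # J) 0) * f (set (i # j # J) - {0}) else 0)"
    if "i \<in> {0..n}" "j \<in> {0..n}" for i j
    unfolding M_def by (rule polarization_q_poly) (use len J that in auto)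
  show ?thesis
    unfolding M_def[symmetric]
  proof (cases "simple_list J")
    case False
    then have "M i j = 0" if "i \<in> {0..n}" "j \<in> {0..n}" for i j
      using M[OF that] by simp
    then have "bil {0..n} M x y = 0" for x y unfolding bil_def by simp
    then show "hyperbolic {0..n} M" unfolding hyperbolic_def by simp
  next
    case True
    define \<tau> where "\<tau> = set J - {0}"
    define k where "k = count_list J 0"
    define R where "R = {1..n} - \<tau>"
    have \<tau>: "\<tau> \<subseteq> {1..n}" using J unfolding \<tau>_def by auto
    have card\<tau>: "k + card \<tau> + 1 = n" using card_simple_list[OF True] len unfolding \<tau>_def k_def by simp
    have cardR: "card R = Suc k"
      using card_Diff_subset[OF _ \<tau>] \<tau> card\<tau> finite_subset[OF \<tau>] unfolding R_def by simp
    have V: "finite {0..n}" "insert 0 R \<subseteq> {0..n}" "0 \<notin> R" unfolding R_def by auto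
    \<comment> \<open>Such an i already occurs in \<open>J\<close>, so a further derivative along it
      annihilates a polynomial of degree 1 in that variable.\<close>
    have zero: "M i j = 0" if "i \<in> {0..n} - insert 0 R" "j \<in> {0..n}" for i j
    proof -
      have "i \<noteq> 0" "i \<in> set J" using that \<tau> unfolding R_def \<tau>_def by auto
      then show ?thesis using M[of i j] that by simp
    qed
    have M00: "M 0 0 = fact (k + 2) * f \<tau>"
      using M[of 0 0] True unfolding k_def \<tau>_def by simp
    have M0: "M 0 i = fact (k + 1) * f (insert i \<tau>)" if "i \<in> R" for i
    proof -
      have "i \<in> {0..n}" "i \<noteq> 0" "i \<notin> set J" using that unfolding R_def \<tau>_def by auto
      then show ?thesis using M[of 0 i] True unfolding k_def \<tau>_def by (simp add: insert_Diff_if)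
    qed
    have Mii: "M i i = 0" if "i \<in> R" for i
      using M[of i i] that unfolding R_def by auto
    have Mij: "M i j = fact k * f (insert i (insert j \<tau>))" if "i \<in> R" "j \<in> R" "i \<noteq> j" for i j
    proof -
      have "i \<in> {0..n}" "i \<noteq> 0" "i \<notin> set J" "j \<in> {0..n}" "j \<noteq> 0" "j \<notin> set J"
        using that unfolding R_def \<tau>_def by auto
      then show ?thesis using M[of i j] True that unfolding k_def \<tau>_def by (simp add: insert_Diff_if)
    qed
    show "hyperbolic {0..n} M"
    \<comment> \<open>For k = 0 the set \<open>\<tau>\<close> has n - 1 elements and lies outside
      the range of the coverage condition; for k > 0 it lies within it.\<close>
    proof (cases k)
      case 0
      then obtain r where r: "R = {r}" using cardR card_1_singletonE by (metis One_nat_def)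
      show ?thesis
      proof (rule hyperbolic_two_variables[OF V(1) _ _ sym])
        show "0 \<le> M 0 0" unfolding M00 using f[OF \<tau>] by simp
      qed (use V zero Mii r in auto)
    next
      case (Suc k')
      then have le: "card \<tau> + 2 \<le> n" using card\<tau> by simp
      obtain g where g: "coverage_function R g"
        "\<And>i. i \<in> R \<Longrightarrow> f (insert i \<tau>) = g {i} + f \<tau>"
        "\<And>i j. i \<in> R \<Longrightarrow> j \<in> R \<Longrightarrow> i \<noteq> j \<Longrightarrow> f (insert i (insert j \<tau>)) = g {i, j} + f \<tau>"
        using strongly_2_coverageE[OF cov \<tau> le] unfolding R_def by metis
      show ?thesis
      proof (rule hyperbolic_coverage[OF V g(1) cardR f[OF \<tau>]])
        show "M 0 i = fact (k + 1) * (g {i} + f \<tau>)" if "i \<in> R" for i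
          using M0 g(2) that by simp
        show "M i j = fact k * (g {i, j} + f \<tau>)" if "i \<in> R" "j \<in> R" "i \<noteq> j" for i j
          using Mij g(3) that by simp
      qed (rule zero Mii; assumption | rule M00 sym)+
    qed
  qed
qed

text \<open>
  Submodularity of the coverage function forces one of f(tau + i + j), f(tau + i + l) to be
  nonzero when f(tau + i + j + l) is, so that x i is joined to the variable y.
\<close>

lemma q_poly_connected:
  assumes f: "\<And>S. S \<subseteq> {1..n} \<Longrightarrow> 0 \<le> f S" and cov: "strongly_2_coverage n f"
    and I: "set I \<subseteq> {0..n}" and len: "length I + 2 = n"
    and ijl: "i \<in> {0..n}" "j \<in> {0..n}" "l \<in> {0..n}" and i0: "i \<noteq> 0"
    and nz: "polarization {0..n} (q_poly n f) (map unit_vec (i # j # l # I)) \<noteq> 0"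
  shows "\<exists>l'\<in>{0..n}. polarization {0..n} (q_poly n f) (map unit_vec (i # 0 # l' # I)) \<noteq> 0"
\<comment> \<open>If y already occurs among the two free indices, the required entry is the given
  one up to the order of its arguments.\<close>
proof (cases "j = 0 \<or> l = 0")
  case True
  moreover have "polarization {0..n} (q_poly n f) (map unit_vec (i # l # j # I)) =
      polarization {0..n} (q_poly n f) (map unit_vec (i # j # l # I))"
    by (rule polarization_mset) simp
  ultimately show ?thesis using nz ijl by metis
next
  case False
  then have nz0: "j \<noteq> 0" "l \<noteq> 0" by auto
  have P: "polarization {0..n} (q_poly n f) (map unit_vec (a # b # c # I)) =
     (if simple_list (a # b # c # I) then
      fact (count_list (a # b # c # I) 0) * f (set (a # b # c # I) - {0}) else 0)"
    if "a \<in> {0..n}" "b \<in> {0..n}" "c \<in> {0..n}" for a b c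
    by (rule polarization_q_poly) (use len I that in auto)
  \<comment> \<open>The link is taken at a set that already contains i, so j and l play the part of
    the pair. Being distinct and outside \<open>\<rho>\<close>, they leave room for |rho| + 2 <=
    n.\<close>
  define \<rho> where "\<rho> = insert i (set I - {0})"
  have simple: "simple_list (i # j # l # I)" and fnz: "f (set (i # j # l # I) - {0}) \<noteq> 0"
    using nz unfolding P[OF ijl] by (auto split: if_splits)
  have dist: "i \<noteq> j" "i \<noteq> l" "j \<noteq> l" "i \<notin> set I" "j \<notin> set I" "l \<notin> set I"
    and sI: "simple_list I"
    using simple i0 nz0 by auto
  have "set (i # j # l # I) - {0} = insert j (insert l \<rho>)"
    using i0 nz0 unfolding \<rho>_def by auto
  then have fnz': "f (insert j (insert l \<rho>)) \<noteq> 0" using fnz by simp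
  have \<rho>: "\<rho> \<subseteq> {1..n}" using I ijl i0 unfolding \<rho>_def by auto
  have jl: "j \<in> {1..n} - \<rho>" "l \<in> {1..n} - \<rho>" using ijl nz0 dist unfolding \<rho>_def by auto
  have "card \<rho> \<le> Suc (length I)"
    using card_simple_list[OF sI] card_insert_le_m1 unfolding \<rho>_def
    by (simp add: card_insert_if)
  have "card (insert j (insert l \<rho>)) \<le> card {1..n}"
    by (rule card_mono) (use \<rho> jl in auto)
  then have le: "card \<rho> + 2 \<le> n"
    using jl dist finite_subset[OF \<rho>] by (simp add: card_insert_if)
  obtain g where g: "coverage_function ({1..n} - \<rho>) g"
    "\<And>i. i \<in> {1..n} - \<rho> \<Longrightarrow> f (insert i \<rho>) = g {i} + f \<rho>"
    "\<And>i j. i \<in> {1..n} - \<rho> \<Longrightarrow> j \<in> {1..n} - \<rho> \<Longrightarrow> i \<noteq> j \<Longrightarrow> f (insert i (insert j \<rho>)) = g {i, j} + f \<rho>"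
    using strongly_2_coverageE[OF cov \<rho> le] by metis
  have "f (insert j \<rho>) \<noteq> 0 \<or> f (insert l \<rho>) \<noteq> 0"
  proof (rule ccontr)
    assume "\<not> ?thesis"
    then have "g {j} + f \<rho> = 0" "g {l} + f \<rho> = 0" using g(2) jl by auto
    moreover have "0 \<le> g {j}" "0 \<le> g {l}" using coverage_singleton_nonneg[OF g(1)] jl by auto
    ultimately have "f (insert j (insert l \<rho>)) \<le> 0"
      using coverage_pair_le[OF g(1) jl] g(3)[OF jl dist(3)] f[OF \<rho>] by simp
    moreover have "0 \<le> f (insert j (insert l \<rho>))" by (rule f) (use \<rho> jl in auto)
    ultimately show False using fnz' by simp
  qed
  then obtain l' where l': "l' \<in> {j, l}" "f (insert l' \<rho>) \<noteq> 0" by blast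
  have "set (i # 0 # l' # I) - {0} = insert l' \<rho>"
    using l'(1) i0 nz0 unfolding \<rho>_def by auto
  moreover have "simple_list (i # 0 # l' # I)" using l'(1) dist sI i0 nz0 by auto
  moreover have l'V: "l' \<in> {0..n}" using l'(1) ijl by auto
  ultimately have "polarization {0..n} (q_poly n f) (map unit_vec (i # 0 # l' # I)) \<noteq> 0"
    using P[OF ijl(1) _ l'V, of 0] l'(2) by simp
  then show ?thesis using l'V by blast
qed

theorem mainTheorem2:
  fixes n :: nat and f :: "nat set \<Rightarrow> real"
  assumes "\<And>S. S \<subseteq> {1..n} \<Longrightarrow> 0 \<le> f S"
    and "strongly_2_coverage n f"
    and "f {} = 0"
  shows "completely_log_concave {0..n} (q_poly n f)"
proof (rule completely_log_concave_if_alexandrov_fenchel[OF _ homogeneous_q_poly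
      nonneg_coeffs_q_poly[OF assms(1)]])
  let ?P = "polarization {0..n} (q_poly n f)"
  fix vs :: "(nat \<Rightarrow> real) list" and x y :: "nat \<Rightarrow> real"
  assume len: "length vs + 2 = n + 1" and vs: "set vs \<subseteq> nonneg_orthant {0..n}"
    and y: "y \<in> nonneg_orthant {0..n}"
  interpret multilinear_form "{0..n}" ?P
    by (rule multilinear_form_polarization) (use nonneg_coeffs_q_poly assms(1) in auto)
  show "?P (x # x # vs) * ?P (y # y # vs) \<le> (?P (x # y # vs))\<^sup>2"
  \<comment> \<open>The variable y is the hub, and m = n - 1 is the degree n + 1 less the two free
    slots. The length of \<open>vs\<close> excludes n = 0, so the subtraction does not
    truncate.\<close>
  proof (rule alexandrov_fenchel[where hub = 0 and m = "n - 1"])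
    show "hyperbolic {0..n} (\<lambda>i j. ?P (map unit_vec (i # j # I)))"
      if "set I \<subseteq> {0..n}" "length I = n - 1" for I
      by (rule hyperbolic_q_poly_quadratic[OF assms(1,2) _ that(1)]) (use that len in auto)
    show "\<exists>l'\<in>{0..n}. ?P (map unit_vec (i # 0 # l' # I)) \<noteq> 0"
      if "set I \<subseteq> {0..n}" "Suc (length I) = n - 1" "i \<in> {0..n}" "j \<in> {0..n}" "l \<in> {0..n}"
        "i \<noteq> 0" "?P (map unit_vec (i # j # l # I)) \<noteq> 0" for I i j l
      by (rule q_poly_connected[OF assms(1,2) that(1) _ that(3-7)]) (use that(2) in auto)
    show "\<And>v i. v \<in> set vs \<Longrightarrow> i \<in> {0..n} \<Longrightarrow> 0 \<le> v i" "\<And>i. i \<in> {0..n} \<Longrightarrow> 0 \<le> y i"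
      using vs y unfolding nonneg_orthant_def by auto
  qed (use len in auto)
qed simp_all

end
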